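(* Let $\Omega\subset\mathbb{R}^2$ be a strictly convex bounded domain with sufficiently smooth boundary, let $\mu>0$ be the Larmor radius, and consider a $2$-periodic inverse magnetic billiard trajectory in $\Omega$ with successive boundary points $P_0,P_1,P_2,P_3$ and corresponding angles $\theta_0,\theta_1,\theta_2,\theta_3$. Let $\ell_1=|P_0P_1|$ and set $$\alpha=\frac{\ell_1}{\mu},\qquad \beta=\cot(\theta_0)+\cot(\theta_3),\qquad \delta=\cot(\theta_1)+\cot(\theta_2).$$ (Here $\alpha,\beta,\delta>0$.) Let $m=\min\{2/\beta,2/\delta\}$ and $M=\max\{2/\beta,2/\delta\}$. If $\beta\neq\delta$, then the $2$-periodic trajectory is - parabolic if and only if $\alpha=m$, $\alpha=M$ or $\alpha=m+M$; - elliptic if and only if $\alpha\in(0,m)\cup(M,m+M)$; - hyperbolic if and only if $\alpha\in(m,M)\cup(m+M,\infty)$. If $\beta=\delta$, then $m=M$ and the $2$-periodic trajectory is - parabolic if and only if $\alpha=m$ or $\alpha=2m$; - elliptic if and only if $\alpha\in(0,m)\cup(m,2m)$; - hyperbolic if and only if $\alpha\in(2m,\infty)$.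
   Context: Inverse magnetic billiards: a charged particle moves in the plane at constant speed. Inside $\Omega$ it moves along straight lines (no magnetic field); outside $\Omega$ it moves, under a constant magnetic field, along circular arcs (Larmor arcs) of fixed radius $\mu>0$ (the Larmor radius), traversed anticlockwise. The trajectory is a continuous curve and its velocity direction is continuous when it crosses $\partial\Omega$ (Larmor arcs are tangent to the adjacent chords at the crossing points). Parametrize $\partial\Omega=\Gamma(s)$ by arc length $s$ anticlockwise, $L=|\partial\Omega|$. Starting at $P_0=\Gamma(s_0)$ with inward-pointing velocity $v_0$ making angle $\theta_0\in(0,\pi)$ with the positively oriented tangent of $\Gamma$ at $P_0$, the particle moves along a straight chord inside $\Omega$ until it meets $\partial\Omega$ at $P_1=\Gamma(s_1)$; $\theta_1$ is the angle between the positively oriented tangent of $\Gamma$ at $P_1$ and $\overrightarrow{P_0P_1}$. It then leaves $\Omega$ and follows the anticlockwise circular arc of radius $\mu$ tangent to the ray $\overrightarrow{P_0P_1}$ at $P_1$, until it re-enters $\Omega$ at $P_2=\Gamma(s_2)$ with velocity $v_2$ making angle $\theta_2$ with the positively oriented tangent of $\Gamma$ at $P_2$. The same convention continues: $P_{2i}$ are re-entry points, $P_{2i+1}$ exit points, $\theta_j$ the angle between the velocity and the positively oriented tangent at $P_j$, with $\theta_j\in(0,\pi)$. The inverse magnetic billiard map is $T:(s_0,\theta_0)\mapsto(s_2,\theta_2)$ on $(\mathbb{R}/L\mathbb{Z})\times(0,\pi)$. A trajectory is $2$-periodic if its initial condition $z$ is a periodic point of $T$ of period $2$ ($T^2(z)=z$,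 $T(z)\ne z$). Stability: use the area-preserving coordinates $z=(s,u)$ with $u=-\cos\theta$, and let $DT$ be the Jacobian matrix of $T$ in these coordinates, $DT=\begin{pmatrix}\partial s_2/\partial s_0&\partial s_2/\partial u_0\\ \partial u_2/\partial s_0&\partial u_2/\partial u_0\end{pmatrix}$ ($T$ being differentiable at the points of the orbit). For a $2$-periodic orbit the stability matrix is $S_2(z)=DT(T(z))\,DT(z)$. The trajectory is called hyperbolic if $|\operatorname{Tr}S_2(z)|>2$, parabolic if $|\operatorname{Tr}S_2(z)|=2$, and elliptic if $|\operatorname{Tr}S_2(z)|<2$. *)

theory Defs
  imports "HOL-Complex_Analysis.Complex_Analysis"
begin

text \<open>
  The plane is identified with the complex numbers: rotating a vector \<open>w\<close> anticlockwise
  by the angle \<open>\<phi>\<close> is \<open>cis \<phi> * w\<close>.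
\<close>

definition strictly_convex :: "'a::real_normed_vector set \<Rightarrow> bool" where
  "strictly_convex S \<longleftrightarrow>
     (\<forall>x\<in>closure S. \<forall>y\<in>closure S. x \<noteq> y \<longrightarrow> open_segment x y \<subseteq> interior S)"

abbreviation tangent :: "(real \<Rightarrow> complex) \<Rightarrow> real \<Rightarrow> complex" where
  "tangent \<Gamma> s \<equiv> vector_derivative \<Gamma> (at s)"

text \<open>
  \<open>\<Gamma>\<close> is the anticlockwise arc length parametrization of the boundary, extended
  \<open>L\<close>-periodically to the real line; unit speed and injectivity on a period make \<open>L\<close> the
  boundary length. ``Sufficiently smooth'' is read as \<open>C\<^sup>2\<close>.
\<close>

definition billiard_table :: "complex set \<Rightarrow> (real \<Rightarrow> complex) \<Rightarrow> real \<Rightarrow> bool" where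
  "billiard_table \<Omega> \<Gamma> L \<longleftrightarrow>
     open \<Omega> \<and> connected \<Omega> \<and> \<Omega> \<noteq> {} \<and> bounded \<Omega> \<and> strictly_convex \<Omega> \<and>
     L > 0 \<and> (\<forall>s. \<Gamma> (s + L) = \<Gamma> s) \<and> inj_on \<Gamma> {0..<L} \<and> range \<Gamma> = frontier \<Omega> \<and>
     \<Gamma> C1_differentiable_on UNIV \<and> tangent \<Gamma> C1_differentiable_on UNIV \<and>
     (\<forall>s. norm (tangent \<Gamma> s) = 1) \<and>
     (\<forall>w\<in>\<Omega>. winding_number (\<lambda>t. \<Gamma> (L * t)) w = 1)"

text \<open>
  A state is a pair \<open>(s, \<theta>)\<close> with \<open>\<theta> \<in> (0, \<pi>)\<close> the angle between the velocity and the
  tangent. As \<open>\<Omega>\<close> lies to the left of the anticlockwise tangent, the velocity at an entry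
  point is \<open>cis \<theta> * tangent \<Gamma> s\<close>, and at an exit point, where it points to the right of the
  tangent, it is \<open>cis (- \<theta>) * tangent \<Gamma> s\<close>.

  Arc length parameters are real numbers, not residues modulo \<open>L\<close>. A chord or arc from
  \<open>\<Gamma> s\<close> ends at a point different from \<open>\<Gamma> s\<close>, and its parameter is normalized to lie in
  \<open>(s, s + L)\<close>. This singles out a lift of the billiard map that commutes with the shift of
  \<open>s\<close> by \<open>L\<close> and has no artificial jumps, so that it can be differentiated.
\<close>

definition entry_velocity :: "(real \<Rightarrow> complex) \<Rightarrow> real \<times> real \<Rightarrow> complex" where
  "entry_velocity \<Gamma> z = cis (snd z) * tangent \<Gamma> (fst z)"

definition exit_velocity :: "(real \<Rightarrow> complex) \<Rightarrow> real \<times> real \<Rightarrow> complex" where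
  "exit_velocity \<Gamma> z = cis (- snd z) * tangent \<Gamma> (fst z)"

definition chord_step ::
  "complex set \<Rightarrow> (real \<Rightarrow> complex) \<Rightarrow> real \<Rightarrow> real \<times> real \<Rightarrow> real \<times> real \<Rightarrow> bool" where
  "chord_step \<Omega> \<Gamma> L z0 z1 \<longleftrightarrow>
     snd z0 \<in> {0<..<pi} \<and> snd z1 \<in> {0<..<pi} \<and> fst z1 \<in> {fst z0<..<fst z0 + L} \<and>
     (\<exists>l>0. \<Gamma> (fst z1) = \<Gamma> (fst z0) + of_real l * entry_velocity \<Gamma> z0) \<and>
     open_segment (\<Gamma> (fst z0)) (\<Gamma> (fst z1)) \<subseteq> \<Omega> \<and>
     exit_velocity \<Gamma> z1 = entry_velocity \<Gamma> z0"

text \<open>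
  The anticlockwise circular motion of radius \<open>\<mu>\<close> starting at \<open>p\<close> with unit velocity \<open>v\<close>
  has centre \<open>p + \<mu> \<i> v\<close>; after turning by \<open>\<phi>\<close> its velocity is \<open>cis \<phi> * v\<close>.
\<close>

definition larmor :: "real \<Rightarrow> complex \<Rightarrow> complex \<Rightarrow> real \<Rightarrow> complex" where
  "larmor \<mu> p v \<phi> = p + of_real \<mu> * \<i> * v - cis \<phi> * (of_real \<mu> * \<i> * v)"

definition arc_step ::
  "complex set \<Rightarrow> (real \<Rightarrow> complex) \<Rightarrow> real \<Rightarrow> real \<Rightarrow> real \<times> real \<Rightarrow> real \<times> real \<Rightarrow> bool" where
  "arc_step \<Omega> \<Gamma> L \<mu> z1 z2 \<longleftrightarrow>
     snd z1 \<in> {0<..<pi} \<and> snd z2 \<in> {0<..<pi} \<and> fst z2 \<in> {fst z1<..<fst z1 + L} \<and>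
     (\<exists>\<tau>>0. (\<forall>\<phi>\<in>{0<..<\<tau>}. larmor \<mu> (\<Gamma> (fst z1)) (exit_velocity \<Gamma> z1) \<phi> \<notin> \<Omega>) \<and>
            \<Gamma> (fst z2) = larmor \<mu> (\<Gamma> (fst z1)) (exit_velocity \<Gamma> z1) \<tau> \<and>
            entry_velocity \<Gamma> z2 = cis \<tau> * exit_velocity \<Gamma> z1)"

definition billiard_step ::
  "complex set \<Rightarrow> (real \<Rightarrow> complex) \<Rightarrow> real \<Rightarrow> real \<Rightarrow> real \<times> real \<Rightarrow> real \<times> real \<Rightarrow> bool" where
  "billiard_step \<Omega> \<Gamma> L \<mu> z0 z2 \<longleftrightarrow> (\<exists>z1. chord_step \<Omega> \<Gamma> L z0 z1 \<and> arc_step \<Omega> \<Gamma> L \<mu> z1 z2)"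

text \<open>
  The map is partial: a trajectory that re-enters \<open>\<Omega>\<close> tangentially has no image in the
  phase space.
\<close>

definition billiard_dom ::
  "complex set \<Rightarrow> (real \<Rightarrow> complex) \<Rightarrow> real \<Rightarrow> real \<Rightarrow> (real \<times> real) set" where
  "billiard_dom \<Omega> \<Gamma> L \<mu> = {z. \<exists>w. billiard_step \<Omega> \<Gamma> L \<mu> z w}"

definition billiard_map ::
  "complex set \<Rightarrow> (real \<Rightarrow> complex) \<Rightarrow> real \<Rightarrow> real \<Rightarrow> real \<times> real \<Rightarrow> real \<times> real" where
  "billiard_map \<Omega> \<Gamma> L \<mu> z = (THE w. billiard_step \<Omega> \<Gamma> L \<mu> z w)"

definition same_state :: "real \<Rightarrow> real \<times> real \<Rightarrow> real \<times> real \<Rightarrow> bool" where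
  "same_state L z w \<longleftrightarrow> (\<exists>k::int. fst w = fst z + of_int k * L) \<and> snd w = snd z"

definition period_two ::
  "complex set \<Rightarrow> (real \<Rightarrow> complex) \<Rightarrow> real \<Rightarrow> real \<Rightarrow> real \<times> real \<Rightarrow> bool" where
  "period_two \<Omega> \<Gamma> L \<mu> z \<longleftrightarrow>
     z \<in> billiard_dom \<Omega> \<Gamma> L \<mu> \<and> billiard_map \<Omega> \<Gamma> L \<mu> z \<in> billiard_dom \<Omega> \<Gamma> L \<mu> \<and>
     same_state L (billiard_map \<Omega> \<Gamma> L \<mu> (billiard_map \<Omega> \<Gamma> L \<mu> z)) z \<and>
     \<not> same_state L (billiard_map \<Omega> \<Gamma> L \<mu> z) z"

definition two_periodic_trajectory ::
  "complex set \<Rightarrow> (real \<Rightarrow> complex) \<Rightarrow> real \<Rightarrow> real \<Rightarrow>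
   real \<times> real \<Rightarrow> real \<times> real \<Rightarrow> real \<times> real \<Rightarrow> real \<times> real \<Rightarrow> bool" where
  "two_periodic_trajectory \<Omega> \<Gamma> L \<mu> z0 z1 z2 z3 \<longleftrightarrow>
     chord_step \<Omega> \<Gamma> L z0 z1 \<and> arc_step \<Omega> \<Gamma> L \<mu> z1 z2 \<and> chord_step \<Omega> \<Gamma> L z2 z3 \<and>
     period_two \<Omega> \<Gamma> L \<mu> z0"

text \<open>The area-preserving coordinates \<open>(s, u)\<close> with \<open>u = - cos \<theta>\<close>.\<close>

definition to_su :: "real \<times> real \<Rightarrow> real^2" where
  "to_su z = vector [fst z, - cos (snd z)]"

definition of_su :: "real^2 \<Rightarrow> real \<times> real" where
  "of_su x = (x $ 1, arccos (- (x $ 2)))"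

definition billiard_map_su ::
  "complex set \<Rightarrow> (real \<Rightarrow> complex) \<Rightarrow> real \<Rightarrow> real \<Rightarrow> real^2 \<Rightarrow> real^2" where
  "billiard_map_su \<Omega> \<Gamma> L \<mu> = to_su \<circ> billiard_map \<Omega> \<Gamma> L \<mu> \<circ> of_su"

text \<open>
  Differentiability of a partial map at a point includes that it is defined nearby; this has
  to be said because \<open>billiard_map\<close> takes an arbitrary value outside its domain.
\<close>

definition billiard_differentiable ::
  "complex set \<Rightarrow> (real \<Rightarrow> complex) \<Rightarrow> real \<Rightarrow> real \<Rightarrow> real \<times> real \<Rightarrow> bool" where
  "billiard_differentiable \<Omega> \<Gamma> L \<mu> z \<longleftrightarrow>
     (\<forall>\<^sub>F x in nhds (to_su z). of_su x \<in> billiard_dom \<Omega> \<Gamma> L \<mu>) \<and>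
     billiard_map_su \<Omega> \<Gamma> L \<mu> differentiable (at (to_su z))"

definition DT ::
  "complex set \<Rightarrow> (real \<Rightarrow> complex) \<Rightarrow> real \<Rightarrow> real \<Rightarrow> real \<times> real \<Rightarrow> real^2^2" where
  "DT \<Omega> \<Gamma> L \<mu> z = jacobian (billiard_map_su \<Omega> \<Gamma> L \<mu>) (at (to_su z))"

definition stability_matrix ::
  "complex set \<Rightarrow> (real \<Rightarrow> complex) \<Rightarrow> real \<Rightarrow> real \<Rightarrow> real \<times> real \<Rightarrow> real^2^2" where
  "stability_matrix \<Omega> \<Gamma> L \<mu> z = DT \<Omega> \<Gamma> L \<mu> (billiard_map \<Omega> \<Gamma> L \<mu> z) ** DT \<Omega> \<Gamma> L \<mu> z"

definition hyperbolic ::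
  "complex set \<Rightarrow> (real \<Rightarrow> complex) \<Rightarrow> real \<Rightarrow> real \<Rightarrow> real \<times> real \<Rightarrow> bool" where
  "hyperbolic \<Omega> \<Gamma> L \<mu> z \<longleftrightarrow> \<bar>trace (stability_matrix \<Omega> \<Gamma> L \<mu> z)\<bar> > 2"

definition parabolic ::
  "complex set \<Rightarrow> (real \<Rightarrow> complex) \<Rightarrow> real \<Rightarrow> real \<Rightarrow> real \<times> real \<Rightarrow> bool" where
  "parabolic \<Omega> \<Gamma> L \<mu> z \<longleftrightarrow> \<bar>trace (stability_matrix \<Omega> \<Gamma> L \<mu> z)\<bar> = 2"

definition elliptic ::
  "complex set \<Rightarrow> (real \<Rightarrow> complex) \<Rightarrow> real \<Rightarrow> real \<Rightarrow> real \<times> real \<Rightarrow> bool" where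
  "elliptic \<Omega> \<Gamma> L \<mu> z \<longleftrightarrow> \<bar>trace (stability_matrix \<Omega> \<Gamma> L \<mu> z)\<bar> < 2"

end

theory Submission
  imports Defs
begin

text \<open>
  Let $v$ be the velocity on the first chord. Going once around the closed trajectory adds up two
  chord vectors and two displacements along Larmor arcs. An arc with velocities $v$ before and $w$
  after it displaces the particle by \<open>\<mu> * \<i> * (v - w)\<close>, so the two arcs cancel, and the two chords
  must be opposite vectors (lemma \<open>closed_double_step_antiparallel\<close>). Hence the chords have equal
  length, each arc is a half circle, and \<open>P0, P1, P2, P3\<close> is a rectangle with sides $l_1$ and
  \<open>2 * \<mu>\<close>. The table lies on the left of all its tangent lines. Applied to the sides of the
  rectangle that join the ends of an arc, this makes all four angles acute, so that \<open>\<beta>\<close> and \<open>\<delta>\<close> are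
  positive.

  For the stability matrix, an infinitesimal change of an entry state \<open>(s, \<theta>)\<close> is described by
  the displacement \<open>sin \<theta> ds\<close> of the particle transverse to its velocity and by the rotation
  \<open>\<kappa> ds + d\<theta>\<close> of that velocity, where \<open>\<kappa>\<close> is the curvature of the boundary. These are quantities of
  the beam of trajectories in the plane, and the curvature drops out of them. Along a chord, the
  transverse displacement changes by $l_1$ times the rotation. Along an arc, the invariant is the
  centre of the Larmor circle, and comparing its differential at both ends of a half circle gives
  the rest. In these coordinates (\<open>beam_frame\<close>) the two derivatives of the billiard map become
  \<open>reversal_matrix\<close> with the parameters \<open>\<delta> / \<mu>\<close> and \<open>\<beta> / \<mu>\<close> (lemma \<open>DT_in_beam_frame\<close>). The frame
  after the second step is the frame before the first, so the trace can be computed from the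
  reversal matrices alone and equals
  \<open>2 - 2 * \<alpha> * (\<beta> + \<delta>) + \<alpha>\<^sup>2 * \<beta> * \<delta>\<close>.
  Subtracting or adding 2 factors this expression, with roots \<open>m + M\<close> or \<open>m\<close> and \<open>M\<close> in \<open>\<alpha>\<close>.

  The derivative of the billiard map can be found without solving for the exit point. Chords are
  parametrized by the boundary parameters of their two ends; in these, both the entry state and
  the circle of the next arc are explicit. Since the billiard map is differentiable at the
  given entry state, the chain rule applies to its composition with the entry state.
\<close>

(* The component operator of vectors would otherwise be ambiguous. *)
no_notation fps_nth (infixl "$" 75)

section \<open>Angles, circular motion and unit vector fields\<close>

lemma cis_eq_upper_half_imp_eq:
  assumes "cis a = cis b" "a \<in> {0<..<pi}" "b \<in> {0<..<pi}"
  shows "a = b"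
proof -
  have "cos a = cos b" using assms(1) by (metis cis.sel(1))
  with assms(2,3) show ?thesis by (metis arccos_cos greaterThanLessThan_iff less_imp_le)
qed

lemma upper_unit_circle_angle:
  assumes "norm w = 1" "Im w > 0"
  shows "arccos (Re w) \<in> {0<..<pi}" and "cis (arccos (Re w)) = w"
proof -
  have sq: "(Re w)\<^sup>2 + (Im w)\<^sup>2 = 1"
    using assms(1) by (metis cmod_power2 power_one)
  moreover have "(Im w)\<^sup>2 > 0" using assms(2) by simp
  ultimately have "(Re w)\<^sup>2 < 1" by linarith
  then have re: "- 1 < Re w" "Re w < 1"
    using abs_square_less_1[of "Re w"] by auto
  then show "arccos (Re w) \<in> {0<..<pi}"
    using arccos_lt_bounded by auto
  have "sqrt (1 - (Re w)\<^sup>2) = sqrt ((Im w)\<^sup>2)"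
    using sq by (intro arg_cong[of _ _ sqrt]) linarith
  then show "cis (arccos (Re w)) = w"
    using re assms(2) by (simp add: complex_eq_iff sin_arccos_abs sin_arccos)
qed

lemma has_vector_derivative_cis: "(cis has_vector_derivative \<i> * cis \<phi>) (at \<phi>)"
  using has_derivative_cis[OF has_derivative_ident] by (simp add: has_vector_derivative_def)

lemma has_vector_derivative_larmor:
  "(larmor \<mu> p v has_vector_derivative of_real \<mu> * (cis \<phi> * v)) (at \<phi>)"
proof -
  have "(larmor \<mu> p v has_vector_derivative 0 - \<i> * cis \<phi> * (of_real \<mu> * \<i> * v)) (at \<phi>)"
    unfolding larmor_def[abs_def]
    by (intro has_vector_derivative_diff has_vector_derivative_const
        has_vector_derivative_mult_left has_vector_derivative_cis)
  moreover have "0 - \<i> * cis \<phi> * (of_real \<mu> * \<i> * v) = of_real \<mu> * (cis \<phi> * v)"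
    by (simp add: algebra_simps)
  ultimately show ?thesis by simp
qed

text \<open>
  The centre is the conserved quantity of the circular motion; this single complex equation
  determines the linearization of an arc.
\<close>

lemma arc_step_same_centre:
  assumes "arc_step \<Omega> \<Gamma> L \<mu> z z'"
  shows "\<Gamma> (fst z) + of_real \<mu> * \<i> * exit_velocity \<Gamma> z
    = \<Gamma> (fst z') + of_real \<mu> * \<i> * entry_velocity \<Gamma> z'"
  using assms by (auto simp: arc_step_def larmor_def)

text \<open>
  Differentiating \<open>V \<bullet> V = 1\<close>: the derivative is a real multiple of \<open>\<i> * V\<close>, and the factor
  is the angular speed of \<open>V\<close>.
\<close>

lemma unit_vector_derivative_orthogonal:
  fixes V :: "real \<Rightarrow> complex"
  assumes der: "(V has_vector_derivative V') (at t)"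
    and unit: "\<forall>\<^sub>F u in nhds t. norm (V u) = 1"
  shows "V' = \<i> * of_real (Im (cnj (V t) * V')) * V t"
proof -
  have "((\<lambda>u. V u \<bullet> V u) has_real_derivative 2 * (V t \<bullet> V')) (at t)"
    unfolding has_real_derivative_iff_has_vector_derivative
    using bounded_bilinear.has_vector_derivative[OF bounded_bilinear_inner der der]
    by (simp add: inner_commute)
  moreover have "((\<lambda>u. V u \<bullet> V u) has_real_derivative 0) (at t)"
  proof (subst DERIV_cong_ev[OF refl _ refl])
    show "\<forall>\<^sub>F u in nhds t. V u \<bullet> V u = 1"
      using unit by eventually_elim (simp add: dot_square_norm)
  qed simp
  ultimately have "V t \<bullet> V' = 0"
    using DERIV_unique by fastforce
  then have "Re (cnj (V t) * V') = 0"
    by (simp add: inner_complex_def)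
  then have "cnj (V t) * V' = \<i> * of_real (Im (cnj (V t) * V'))"
    by (simp only: complex_eq_iff) simp
  moreover have "cnj (V t) * V t = 1"
    using eventually_nhds_x_imp_x[OF unit]
    by (metis complex_norm_square mult.commute of_real_1 power_one)
  ultimately show ?thesis by algebra
qed

lemma has_vector_derivative_vector_2:
  assumes "(f has_real_derivative f') (at t)" "(g has_real_derivative g') (at t)"
  shows "((\<lambda>t. vector [f t, g t] :: real^2) has_vector_derivative vector [f', g']) (at t)"
proof -
  have vec: "(vector [x, y] :: real^2) = x *\<^sub>R axis 1 1 + y *\<^sub>R axis 2 1" for x y
    by (simp add: vec_eq_iff forall_2 axis_def)
  have "((\<lambda>t. f t *\<^sub>R c) has_vector_derivative f' *\<^sub>R c) (at t)"
    if "(f has_real_derivative f') (at t)" for f f' and c :: "real^2"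
    using has_vector_derivative_scaleR[OF that has_vector_derivative_const] by simp
  with assms show ?thesis
    unfolding vec by (intro has_vector_derivative_add)
qed

section \<open>The trace of a product of two reversals and its sign pattern\<close>

text \<open>
  The matrix that turns \<open>(ds, du)\<close> into the displacement to the right of the velocity and the
  rotation of the velocity at an entry point: \<open>u = - cos \<theta>\<close> gives \<open>d\<theta> = du / sin \<theta>\<close>.
\<close>

definition beam_frame :: "real \<Rightarrow> real \<Rightarrow> real^2^2" where
  "beam_frame \<kappa> \<theta> = vector [vector [sin \<theta>, 0], vector [\<kappa>, 1 / sin \<theta>]]"

text \<open>
  A beam displaced by \<open>n\<close> to the right of its velocity and rotated by \<open>b\<close> arrives at the end of a
  chord of length \<open>l\<close> displaced by \<open>l * b - n\<close> to the left. A half circle reverses the velocity,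
  which makes this a displacement to the right, and turns the rotation into
  \<open>c * (l * b - n) - b\<close>.
\<close>

definition reversal_matrix :: "real \<Rightarrow> real \<Rightarrow> real^2^2" where
  "reversal_matrix l c = vector [vector [- 1, l], vector [- c, l * c - 1]]"

lemma invertible_beam_frame:
  assumes "\<theta> \<in> {0<..<pi}"
  shows "invertible (beam_frame \<kappa> \<theta>)"
  using assms sin_gt_zero[of \<theta>] by (auto simp: invertible_det_nz det_2 beam_frame_def)

lemma trace_reversal_matrix_mult:
  "trace (reversal_matrix l c ** reversal_matrix l d) = 2 - 2 * l * (c + d) + l\<^sup>2 * c * d"
  by (simp add: trace_def sum_2 matrix_matrix_mult_def reversal_matrix_def algebra_simps power2_eq_square)

text \<open>
  \<open>A\<close> and \<open>B\<close> are the derivatives along the two steps of a closed orbit, \<open>F\<close> and \<open>G\<close> the frames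
  at its start and at its intermediate point. The intermediate frame cancels in the product, and
  cyclicity of the trace removes the outer one.
\<close>

lemma trace_cyclic_conjugation:
  fixes A B F G P Q :: "real^'n^'n"
  assumes "invertible F" "F ** B = Q ** G" "G ** A = P ** F"
  shows "trace (B ** A) = trace (Q ** P)"
proof -
  obtain F' where F': "F ** F' = mat 1" "F' ** F = mat 1"
    using assms(1) by (auto simp: invertible_def)
  have "B ** A = F' ** (F ** B) ** A"
    by (simp add: matrix_mul_assoc F')
  also have "\<dots> = F' ** (Q ** P ** F)"
    by (simp add: assms matrix_mul_assoc[symmetric])
  finally have "trace (B ** A) = trace (F' ** (Q ** P ** F))"
    by simp
  also have "\<dots> = trace (Q ** P ** F ** F')"
    by (rule trace_mul_sym)
  also have "Q ** P ** F ** F' = Q ** P"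
    by (simp add: matrix_mul_assoc[symmetric] F')
  finally show ?thesis .
qed

text \<open>
  With \<open>K = \<beta> * \<delta>\<close> the definition of \<open>t\<close> factors in two ways, as
  \<open>t - 2 = K * \<alpha> * (\<alpha> - (m + M))\<close> and \<open>t + 2 = K * (\<alpha> - m) * (\<alpha> - M)\<close>.
\<close>

lemma stability_classification:
  fixes \<alpha> \<beta> \<delta> t :: real
  assumes pos: "\<alpha> > 0" "\<beta> > 0" "\<delta> > 0"
    and t: "t = 2 - 2 * \<alpha> * (\<beta> + \<delta>) + \<alpha>\<^sup>2 * \<beta> * \<delta>"
    and m: "m = min (2 / \<beta>) (2 / \<delta>)" and M: "M = max (2 / \<beta>) (2 / \<delta>)"
  shows "\<bar>t\<bar> = 2 \<longleftrightarrow> \<alpha> = m \<or> \<alpha> = M \<or> \<alpha> = m + M"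
    and "\<bar>t\<bar> < 2 \<longleftrightarrow> 0 < \<alpha> \<and> \<alpha> < m \<or> M < \<alpha> \<and> \<alpha> < m + M"
    and "\<bar>t\<bar> > 2 \<longleftrightarrow> m < \<alpha> \<and> \<alpha> < M \<or> m + M < \<alpha>"
proof -
  have mM: "0 < m" "m \<le> M" using pos by (auto simp: m M)
  have sum: "m + M = 2 / \<beta> + 2 / \<delta>" by (auto simp: m M min_def max_def)
  have prod: "(\<alpha> - m) * (\<alpha> - M) = (\<alpha> - 2 / \<beta>) * (\<alpha> - 2 / \<delta>)" by (auto simp: m M min_def max_def)
  have above: "t - 2 = (\<beta> * \<delta> * \<alpha>) * (\<alpha> - (m + M))"
    unfolding t sum using pos by (simp add: field_simps power2_eq_square)
  have below: "t + 2 = (\<beta> * \<delta>) * ((\<alpha> - m) * (\<alpha> - M))"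
    unfolding t prod using pos by (simp add: field_simps power2_eq_square)
  have K: "\<beta> * \<delta> * \<alpha> > 0" "\<beta> * \<delta> > 0" using pos by auto
  have "t > 2 \<longleftrightarrow> m + M < \<alpha>"
    using above K by (metis diff_gt_0_iff_gt zero_less_mult_pos mult_pos_pos)
  moreover have "t = 2 \<longleftrightarrow> \<alpha> = m + M"
    using above K by auto
  moreover have "t < - 2 \<longleftrightarrow> m < \<alpha> \<and> \<alpha> < M"
  proof -
    have "t < - 2 \<longleftrightarrow> (\<alpha> - m) * (\<alpha> - M) < 0"
      using below K(2) by (metis less_minus_iff minus_less_iff add.inverse_inverse real_add_less_0_iff mult_less_0_iff less_asym)
    then show ?thesis using mM by (auto simp: mult_less_0_iff)
  qed
  moreover have "t = - 2 \<longleftrightarrow> \<alpha> = m \<or> \<alpha> = M"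
  proof -
    have "t = - 2 \<longleftrightarrow> t + 2 = 0" by linarith
    then show ?thesis unfolding below using pos by simp
  qed
  ultimately show "\<bar>t\<bar> = 2 \<longleftrightarrow> \<alpha> = m \<or> \<alpha> = M \<or> \<alpha> = m + M"
    and "\<bar>t\<bar> < 2 \<longleftrightarrow> 0 < \<alpha> \<and> \<alpha> < m \<or> M < \<alpha> \<and> \<alpha> < m + M"
    and "\<bar>t\<bar> > 2 \<longleftrightarrow> m < \<alpha> \<and> \<alpha> < M \<or> m + M < \<alpha>"
    using pos mM by argo+
qed

section \<open>The side of a tangent line on which the table lies\<close>

definition curvature :: "(real \<Rightarrow> complex) \<Rightarrow> real \<Rightarrow> real" where
  "curvature \<Gamma> s = Im (cnj (tangent \<Gamma> s) * vector_derivative (tangent \<Gamma>) (at s))"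

context
  fixes \<Omega> :: "complex set" and \<Gamma> :: "real \<Rightarrow> complex" and L :: real
  assumes table: "billiard_table \<Omega> \<Gamma> L"
begin

lemma has_vector_derivative_boundary: "(\<Gamma> has_vector_derivative tangent \<Gamma> s) (at s)"
  using table by (auto simp: billiard_table_def C1_differentiable_on_eq vector_derivative_works)

lemma has_vector_derivative_tangent:
  "(tangent \<Gamma> has_vector_derivative vector_derivative (tangent \<Gamma>) (at s)) (at s)"
  using table
  by (auto simp: billiard_table_def C1_differentiable_on_eq[of "tangent \<Gamma>"] vector_derivative_works)

lemma continuous_boundary: "isCont \<Gamma> s"
  using has_vector_derivative_boundary by (rule has_vector_derivative_continuous)

lemma continuous_tangent: "isCont (tangent \<Gamma>) s"
  using has_vector_derivative_tangent by (rule has_vector_derivative_continuous)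

lemma norm_tangent [simp]: "norm (tangent \<Gamma> s) = 1"
  using table by (simp add: billiard_table_def)

lemma cnj_tangent_mult [simp]: "cnj (tangent \<Gamma> s) * tangent \<Gamma> s = 1"
  using norm_tangent[of s] by (metis complex_norm_square mult.commute of_real_1 power_one)

lemma tangent_mult_cnj [simp]: "tangent \<Gamma> s * cnj (tangent \<Gamma> s) = 1"
  using cnj_tangent_mult[of s] by (simp add: mult.commute)

lemma boundary_in_frontier [simp]: "\<Gamma> s \<in> frontier \<Omega>"
  using table by (auto simp: billiard_table_def)

lemma open_table: "open \<Omega>"
  using table by (simp add: billiard_table_def)

lemma boundary_notin_table [simp]: "\<Gamma> s \<notin> \<Omega>"
  using boundary_in_frontier[of s] open_table by (auto simp: frontier_def interior_open)

lemma boundary_in_closure [simp]: "\<Gamma> s \<in> closure \<Omega>"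
  using boundary_in_frontier[of s] by (auto simp: frontier_def)

lemma open_segment_in_table:
  assumes "x \<in> closure \<Omega>" "y \<in> closure \<Omega>" "x \<noteq> y"
  shows "open_segment x y \<subseteq> \<Omega>"
  using table assms unfolding billiard_table_def strictly_convex_def
  by (metis interior_open)

lemma convex_table: "convex \<Omega>"
  unfolding convex_contains_segment
proof (intro ballI)
  fix a b assume "a \<in> \<Omega>" "b \<in> \<Omega>"
  then show "closed_segment a b \<subseteq> \<Omega>"
    using open_segment_in_table[of a b] closure_subset[of \<Omega>]
    by (cases "a = b") (auto simp: closed_segment_eq_open)
qed

text \<open>
  Lifts of the billiard map return to a state only up to a multiple of the period; the following
  three lemmas identify the position, the tangent and the curvature at such parameters.
\<close>

lemma boundary_shift: "\<Gamma> (s + of_int k * L) = \<Gamma> s"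
proof -
  have per: "\<Gamma> (s + L) = \<Gamma> s" for s
    using table by (auto simp: billiard_table_def)
  have nat: "\<Gamma> (s + of_nat n * L) = \<Gamma> s" for n s
  proof (induction n)
    case (Suc n)
    have "\<Gamma> (s + of_nat (Suc n) * L) = \<Gamma> (s + of_nat n * L + L)"
      by (simp add: algebra_simps)
    with Suc per show ?case by simp
  qed simp
  show ?thesis
  proof (cases "k \<ge> 0")
    case True
    then show ?thesis using nat[of s "nat k"] by simp
  next
    case False
    then show ?thesis using nat[of "s + of_int k * L" "nat (-k)"] by simp
  qed
qed

lemma tangent_shift: "tangent \<Gamma> (s + of_int k * L) = tangent \<Gamma> s"
proof -
  have "((\<lambda>t. \<Gamma> (t + of_int k * L)) has_vector_derivative tangent \<Gamma> (s + of_int k * L)) (at s)"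
    using has_vector_derivative_boundary[of "s + of_int k * L"]
    by (rule vector_diff_chain_at[of "\<lambda>t. t + of_int k * L" 1, unfolded o_def, simplified, rotated])
      (auto intro!: derivative_eq_intros)
  then show ?thesis
    by (simp add: boundary_shift vector_derivative_at)
qed

lemma tangent_derivative_shift:
  "vector_derivative (tangent \<Gamma>) (at (s + of_int k * L)) = vector_derivative (tangent \<Gamma>) (at s)"
proof -
  have "((\<lambda>t. tangent \<Gamma> (t + of_int k * L)) has_vector_derivative
      vector_derivative (tangent \<Gamma>) (at (s + of_int k * L))) (at s)"
    using has_vector_derivative_tangent[of "s + of_int k * L"]
    by (rule vector_diff_chain_at[of "\<lambda>t. t + of_int k * L" 1, unfolded o_def, simplified, rotated])
      (auto intro!: derivative_eq_intros)
  then show ?thesis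
    by (simp add: tangent_shift vector_derivative_at)
qed

lemma boundary_injective:
  assumes "\<Gamma> s = \<Gamma> t" "\<bar>s - t\<bar> < L"
  shows "s = t"
proof -
  have L: "L > 0" and inj: "inj_on \<Gamma> {0..<L}"
    using table by (auto simp: billiard_table_def)
  \<comment> \<open>the representative of a parameter modulo \<open>L\<close> in the interval on which \<open>\<Gamma>\<close> is injective\<close>
  define r where "r x = x + of_int (- \<lfloor>x / L\<rfloor>) * L" for x
  have r: "r x \<in> {0..<L}" for x
    using floor_divide_lower[OF L, of x] floor_divide_upper[OF L, of x]
    unfolding r_def atLeastLessThan_iff of_int_minus minus_mult_left[symmetric] distrib_right mult_1
    by linarith
  have "\<Gamma> (r x) = \<Gamma> x" for x
    unfolding r_def by (rule boundary_shift)
  with assms(1) inj r have "r s = r t"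
    by (metis inj_onD)
  then have eq: "s - t = of_int (\<lfloor>s / L\<rfloor> - \<lfloor>t / L\<rfloor>) * L"
    by (simp add: r_def algebra_simps)
  with assms(2) L have "\<bar>real_of_int (\<lfloor>s / L\<rfloor> - \<lfloor>t / L\<rfloor>)\<bar> < 1"
    by (simp add: abs_mult)
  then have "\<lfloor>s / L\<rfloor> - \<lfloor>t / L\<rfloor> = 0"
    by linarith
  with eq show ?thesis by simp
qed

text \<open>
  At its minimum \<open>s\<close> along the boundary, a supporting functional has zero derivative in the
  direction of the tangent, so it is a multiple of the signed distance to the tangent line.
\<close>

lemma support_normal:
  assumes le: "\<And>w. w \<in> \<Omega> \<Longrightarrow> a \<bullet> \<Gamma> s \<le> a \<bullet> w"
  obtains c where "\<And>v. a \<bullet> v = c * Im (cnj (tangent \<Gamma> s) * v)"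
proof -
  have le': "a \<bullet> \<Gamma> s \<le> a \<bullet> \<Gamma> t" for t
    using continuous_ge_on_closure[of \<Omega> "\<lambda>w. a \<bullet> w" "\<Gamma> t" "a \<bullet> \<Gamma> s"] le
    by (simp add: linear_continuous_on bounded_linear_inner_right)
  have "((\<lambda>t. a \<bullet> \<Gamma> t) has_real_derivative a \<bullet> tangent \<Gamma> s) (at s)"
    unfolding has_real_derivative_iff_has_vector_derivative
    by (rule bounded_linear.has_vector_derivative[OF bounded_linear_inner_right
          has_vector_derivative_boundary])
  then have "a \<bullet> tangent \<Gamma> s = 0"
    using le' by (intro DERIV_local_min[of _ _ s 1]) auto
  then have orth: "Re (cnj a * tangent \<Gamma> s) = 0"
    by (simp add: inner_complex_def)
  let ?g = "tangent \<Gamma> s"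
  show thesis
  proof
    fix v
    have "cnj a * v = (cnj a * ?g) * (cnj ?g * v)"
      by (metis mult.assoc mult_1 tangent_mult_cnj)
    then have "Re (cnj a * v) = - Im (cnj a * ?g) * Im (cnj ?g * v)"
      by (simp only: times_complex.sel(1)[of "cnj a * ?g"] orth mult_zero_left diff_0 mult_minus_left)
    then show "a \<bullet> v = - Im (cnj a * ?g) * Im (cnj ?g * v)"
      by (simp add: inner_complex_def)
  qed
qed

lemma table_avoids_tangent_line:
  assumes "w \<in> \<Omega>"
  shows "Im (cnj (tangent \<Gamma> s) * (w - \<Gamma> s)) \<noteq> 0"
proof -
  have ri: "rel_interior \<Omega> = \<Omega>"
    by (rule rel_interior_open[OF open_table])
  obtain a where lt: "\<And>y. y \<in> \<Omega> \<Longrightarrow> a \<bullet> \<Gamma> s < a \<bullet> y"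
    using supporting_hyperplane_relative_frontier[OF convex_table boundary_in_closure[of s]]
    by (metis ri boundary_notin_table)
  then obtain c where "\<And>v. a \<bullet> v = c * Im (cnj (tangent \<Gamma> s) * v)"
    by (metis support_normal less_imp_le)
  with lt[OF assms] show ?thesis
    by (metis diff_gt_0_iff_gt inner_diff_right less_irrefl mult_zero_right)
qed

text \<open>
  By \<open>table_avoids_tangent_line\<close> and continuity, the side of the tangent on which a fixed point
  of the table lies is the same along the whole boundary. If it were the right side, the argument
  of the vector from the point to the boundary would decrease monotonically, which
  contradicts winding number 1.
\<close>

lemma table_left_of_tangent:
  assumes w: "w \<in> \<Omega>"
  shows "Im (cnj (tangent \<Gamma> s) * (w - \<Gamma> s)) > 0"
proof (rule ccontr)
  define f where "f t = Im (cnj (tangent \<Gamma> t) * (w - \<Gamma> t))" for t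
  have L: "L > 0" and wind: "winding_number (\<lambda>t. \<Gamma> (L * t)) w = 1"
    using table w by (auto simp: billiard_table_def)
  have cont: "continuous_on UNIV f"
    unfolding f_def
    by (intro continuous_at_imp_continuous_on ballI continuous_intros continuous_boundary continuous_tangent)
  have nz: "f t \<noteq> 0" for t
    unfolding f_def by (rule table_avoids_tangent_line[OF w])
  assume "\<not> ?thesis"
  with nz[of s] have "f s < 0" by (simp add: f_def)
  have neg: "f t < 0" for t
  proof (rule ccontr)
    assume "\<not> f t < 0"
    moreover have "connected (f ` UNIV)"
      by (rule connected_continuous_image[OF cont]) simp
    ultimately have "0 \<in> f ` UNIV"
      using \<open>f s < 0\<close> by (intro connectedD_interval[of "f ` UNIV" "f s" "f t" 0]) auto
    with nz show False by auto
  qed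
  define \<gamma> where "\<gamma> t = \<Gamma> (L * t)" for t
  have der: "(\<gamma> has_vector_derivative (L *\<^sub>R tangent \<Gamma> (L * t))) (at t)" for t
    unfolding \<gamma>_def
    by (rule vector_diff_chain_at[of "\<lambda>t. L * t" L, unfolded o_def])
      (auto intro!: derivative_eq_intros has_vector_derivative_boundary)
  have "\<gamma> C1_differentiable_on UNIV"
    unfolding C1_differentiable_on_def
  proof (intro exI conjI ballI)
    show "(\<gamma> has_vector_derivative (L *\<^sub>R tangent \<Gamma> (L * t))) (at t)" for t by (rule der)
    show "continuous_on UNIV (\<lambda>t. L *\<^sub>R tangent \<Gamma> (L * t))"
      by (intro continuous_at_imp_continuous_on ballI continuous_intros
            isCont_o2[OF _ continuous_tangent])
  qed
  then have valid: "valid_path \<gamma>"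
    unfolding valid_path_def
    by (intro C1_differentiable_imp_piecewise) (auto intro: C1_differentiable_on_subset)
  have notin: "w \<notin> path_image \<gamma>"
    using w boundary_notin_table by (auto simp: path_image_def \<gamma>_def)
  \<comment> \<open>The reversed path turns anticlockwise around \<open>w\<close>.\<close>
  have "0 \<le> Re (winding_number (reversepath \<gamma>) w)"
  proof (rule winding_number_pos_le)
    fix x :: real
    have "(reversepath \<gamma> has_vector_derivative (- 1) *\<^sub>R (L *\<^sub>R tangent \<Gamma> (L * (1 - x)))) (at x)"
      unfolding reversepath_def
      by (rule vector_diff_chain_at[of "\<lambda>t. 1 - t", unfolded o_def])
        (auto intro!: derivative_eq_intros der)
    then have "vector_derivative (reversepath \<gamma>) (at x) = - (L *\<^sub>R tangent \<Gamma> (L * (1 - x)))"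
      by (simp add: vector_derivative_at)
    then have "Im (vector_derivative (reversepath \<gamma>) (at x) * cnj (reversepath \<gamma> x - w))
        = - L * f (L * (1 - x))"
      by (simp add: reversepath_def \<gamma>_def f_def algebra_simps)
    then show "0 \<le> Im (vector_derivative (reversepath \<gamma>) (at x) * cnj (reversepath \<gamma> x - w))"
      using neg[of "L * (1 - x)"] L by (simp add: mult_pos_neg less_imp_le)
  qed (use valid notin in \<open>auto intro: valid_path_imp_reverse\<close>)
  moreover have "winding_number (reversepath \<gamma>) w = - 1"
    using winding_number_reversepath[of \<gamma> w] valid notin wind
    by (simp add: valid_path_imp_path \<gamma>_def[abs_def])
  ultimately show False by simp
qed

text \<open>
  Strict convexity puts the midpoint of a chord into the open table, which makes the inequality
  strict for boundary points too.
\<close>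

lemma boundary_left_of_tangent:
  assumes "\<Gamma> t \<noteq> \<Gamma> s"
  shows "Im (cnj (tangent \<Gamma> s) * (\<Gamma> t - \<Gamma> s)) > 0"
proof -
  have "midpoint (\<Gamma> s) (\<Gamma> t) \<in> \<Omega>"
    using open_segment_in_table[of "\<Gamma> s" "\<Gamma> t"] assms by (auto simp: midpoint_in_open_segment)
  from table_left_of_tangent[OF this, of s] show ?thesis
    by (simp add: midpoint_def algebra_simps)
qed

text \<open>
  Otherwise a line separates the ray from the table. It supports the table at the starting point,
  so it is the tangent line; but the ray and the table lie on the same side of that line.
\<close>

lemma inward_ray_meets_table:
  assumes v: "Im (cnj (tangent \<Gamma> s) * v) > 0"
  obtains r where "r > 0" "\<Gamma> s + r *\<^sub>R v \<in> \<Omega>"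
proof (rule ccontr)
  assume no: "\<not> thesis"
  define R where "R = (\<lambda>r. \<Gamma> s + r *\<^sub>R v) ` {0<..}"
  have "convex R"
  proof -
    have "R = (+) (\<Gamma> s) ` ((\<lambda>r. r *\<^sub>R v) ` {0<..})"
      by (auto simp: R_def image_image)
    then show ?thesis
      by (auto intro!: convex_translation convex_linear_image bounded_linear.linear
          bounded_linear_scaleR_left)
  qed
  moreover have "\<Omega> \<inter> R = {}"
    using no that by (auto simp: R_def)
  moreover have ne: "\<Omega> \<noteq> {}"
    using table by (simp add: billiard_table_def)
  ultimately obtain a b where "a \<noteq> 0"
    and ab: "\<And>x. x \<in> R \<Longrightarrow> a \<bullet> x \<le> b" "\<And>x. x \<in> \<Omega> \<Longrightarrow> b \<le> a \<bullet> x"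
    using separating_hyperplane_sets[of R \<Omega>] convex_table
    by (metis Int_commute R_def greaterThan_iff image_is_empty greaterThan_non_empty)
  have "a \<bullet> \<Gamma> s \<le> b"
  proof (rule tendsto_upperbound)
    show "((\<lambda>r. a \<bullet> (\<Gamma> s + r *\<^sub>R v)) \<longlongrightarrow> a \<bullet> \<Gamma> s) (at_right 0)"
      by (auto intro!: tendsto_eq_intros)
    show "\<forall>\<^sub>F r in at_right 0. a \<bullet> (\<Gamma> s + r *\<^sub>R v) \<le> b"
      using eventually_at_right_less by eventually_elim (use ab(1) in \<open>auto simp: R_def\<close>)
  qed simp
  moreover have "b \<le> a \<bullet> \<Gamma> s"
    using continuous_ge_on_closure[of \<Omega> "\<lambda>w. a \<bullet> w" "\<Gamma> s" b] ab(2)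
    by (simp add: linear_continuous_on bounded_linear_inner_right)
  ultimately have b: "b = a \<bullet> \<Gamma> s" by simp
  obtain c where c: "\<And>v. a \<bullet> v = c * Im (cnj (tangent \<Gamma> s) * v)"
    using support_normal ab(2) b by metis
  have "a \<bullet> (\<Gamma> s + 1 *\<^sub>R v) \<le> b"
    unfolding R_def[symmetric] by (rule ab(1), unfold R_def, rule imageI) simp
  then have "a \<bullet> v \<le> 0" by (simp add: b inner_add_right)
  then have "c \<le> 0" using v c by (simp add: mult_le_0_iff)
  obtain w where w: "w \<in> \<Omega>" using ne by auto
  then have "a \<bullet> (w - \<Gamma> s) \<ge> 0" using ab(2) b by (simp add: inner_diff_right)
  then have "c \<ge> 0" using table_left_of_tangent[OF w, of s] c by (simp add: zero_le_mult_iff)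
  with \<open>c \<le> 0\<close> have "a \<bullet> a = 0" by (simp add: c)
  with \<open>a \<noteq> 0\<close> show False by simp
qed

text \<open>
  The secants from the starting point converge in direction to \<open>v\<close>, so a point at fixed small
  distance on them lies in the open table; convexity fills in the segment.
\<close>

lemma inward_curve_enters_table:
  assumes c: "(c has_vector_derivative v) (at \<tau>)" "c \<tau> = \<Gamma> s"
    and v: "Im (cnj (tangent \<Gamma> s) * v) > 0"
  shows "\<forall>\<^sub>F t in at_right \<tau>. c t \<in> \<Omega>"
proof -
  obtain r where r: "r > 0" "\<Gamma> s + r *\<^sub>R v \<in> \<Omega>"
    using inward_ray_meets_table[OF v] .
  define q where "q t = \<Gamma> s + r *\<^sub>R ((c t - c \<tau>) /\<^sub>R (t - \<tau>))" for t
  have "((\<lambda>t. norm (c t - c \<tau> - (t - \<tau>) *\<^sub>R v) / \<bar>t - \<tau>\<bar>) \<longlongrightarrow> 0) (at_right \<tau>)"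
    using has_vector_derivative_at_within[OF c(1), of "{\<tau><..}"]
    by (simp add: has_vector_derivative_def has_derivative_iff_norm)
  moreover have "\<forall>\<^sub>F t in at_right \<tau>.
      norm (c t - c \<tau> - (t - \<tau>) *\<^sub>R v) / \<bar>t - \<tau>\<bar> = norm ((c t - c \<tau>) /\<^sub>R (t - \<tau>) - v)"
    using eventually_at_right_less[of \<tau>]
  proof eventually_elim
    case (elim t)
    have "norm (x - h *\<^sub>R v) / \<bar>h\<bar> = norm (x /\<^sub>R h - v)" if "h > 0" for x and h :: real
    proof -
      have "x /\<^sub>R h - v = (x - h *\<^sub>R v) /\<^sub>R h"
        using that by (simp add: scaleR_diff_right)
      then show ?thesis
        using that by (simp add: divide_inverse_commute)
    qed
    from this[of "t - \<tau>" "c t - c \<tau>"] elim show ?case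
      by (simp only: diff_gt_0_iff_gt)
  qed
  ultimately have "((\<lambda>t. norm ((c t - c \<tau>) /\<^sub>R (t - \<tau>) - v)) \<longlongrightarrow> 0) (at_right \<tau>)"
    by (rule Lim_transform_eventually)
  then have "((\<lambda>t. (c t - c \<tau>) /\<^sub>R (t - \<tau>)) \<longlongrightarrow> v) (at_right \<tau>)"
    by (rule LIM_zero_cancel[OF tendsto_norm_zero_cancel])
  then have "(q \<longlongrightarrow> \<Gamma> s + r *\<^sub>R v) (at_right \<tau>)"
    unfolding q_def by (intro tendsto_intros)
  then have "\<forall>\<^sub>F t in at_right \<tau>. q t \<in> \<Omega>"
    using open_table r(2) by (rule topological_tendstoD)
  moreover have "\<forall>\<^sub>F t in at_right \<tau>. t \<in> {\<tau><..<\<tau> + r}"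
    using r(1) by (intro eventually_at_right_real) simp
  ultimately show ?thesis
  proof eventually_elim
    case (elim t)
    define u where "u = (t - \<tau>) / r"
    have u: "0 < u" "u < 1" using elim r by (auto simp: u_def)
    have "q t \<noteq> \<Gamma> s" using elim by force
    have "u * r * inverse (t - \<tau>) = 1"
      using elim r by (simp add: u_def)
    then have "u *\<^sub>R q t = u *\<^sub>R \<Gamma> s + (c t - \<Gamma> s)"
      using c(2) by (simp add: q_def scaleR_add_right mult.assoc)
    then have "c t = (1 - u) *\<^sub>R \<Gamma> s + u *\<^sub>R q t"
      by (simp add: algebra_simps)
    with u \<open>q t \<noteq> \<Gamma> s\<close> have "c t \<in> open_segment (\<Gamma> s) (q t)"
      by (auto simp: in_segment)
    then show ?case
      using open_segment_in_table[of "\<Gamma> s" "q t"] \<open>q t \<noteq> \<Gamma> s\<close> elim closure_subset by fastforce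
  qed
qed

section \<open>Determinism of the billiard step\<close>

lemma norm_entry_velocity: "norm (entry_velocity \<Gamma> z) = 1"
  by (simp add: entry_velocity_def norm_mult norm_tangent)

lemma cnj_tangent_mult_entry_velocity:
  "cnj (tangent \<Gamma> (fst z)) * entry_velocity \<Gamma> z = cis (snd z)"
  using cnj_tangent_mult[of "fst z"]
  by (simp add: entry_velocity_def mult.left_commute)

lemma cnj_tangent_mult_exit_velocity:
  "cnj (tangent \<Gamma> (fst z)) * exit_velocity \<Gamma> z = cis (- snd z)"
  using cnj_tangent_mult[of "fst z"]
  by (simp add: exit_velocity_def mult.left_commute)

lemma entry_state_unique:
  assumes "fst z = fst z'" "entry_velocity \<Gamma> z = entry_velocity \<Gamma> z'"
    and "snd z \<in> {0<..<pi}" "snd z' \<in> {0<..<pi}"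
  shows "z = z'"
proof -
  have "cis (snd z) = cis (snd z')"
    using assms(1,2) cnj_tangent_mult_entry_velocity by metis
  with assms show ?thesis
    by (metis prod_eqI cis_eq_upper_half_imp_eq)
qed

lemma exit_state_unique:
  assumes "fst z = fst z'" "exit_velocity \<Gamma> z = exit_velocity \<Gamma> z'"
    and "snd z \<in> {0<..<pi}" "snd z' \<in> {0<..<pi}"
  shows "z = z'"
proof -
  have "cis (- snd z) = cis (- snd z')"
    using assms(1,2) cnj_tangent_mult_exit_velocity by metis
  then have "cis (snd z) = cis (snd z')"
    by (metis cis_cnj complex_cnj_cancel_iff)
  with assms show ?thesis
    by (metis prod_eqI cis_eq_upper_half_imp_eq)
qed

lemma chord_step_velocity:
  assumes "chord_step \<Omega> \<Gamma> L z z'"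
  shows "\<Gamma> (fst z') \<noteq> \<Gamma> (fst z)"
    and "entry_velocity \<Gamma> z = sgn (\<Gamma> (fst z') - \<Gamma> (fst z))"
    and "\<Gamma> (fst z') = \<Gamma> (fst z) + of_real (norm (\<Gamma> (fst z') - \<Gamma> (fst z))) * entry_velocity \<Gamma> z"
proof -
  obtain l where l: "l > 0" "\<Gamma> (fst z') = \<Gamma> (fst z) + of_real l * entry_velocity \<Gamma> z"
    using assms by (auto simp: chord_step_def)
  then show "\<Gamma> (fst z') \<noteq> \<Gamma> (fst z)"
    using norm_entry_velocity[of z] by auto
  show "entry_velocity \<Gamma> z = sgn (\<Gamma> (fst z') - \<Gamma> (fst z))"
    using l norm_entry_velocity[of z]
    by (simp add: sgn_div_norm norm_mult scaleR_conv_of_real)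
  show "\<Gamma> (fst z') = \<Gamma> (fst z) + of_real (norm (\<Gamma> (fst z') - \<Gamma> (fst z))) * entry_velocity \<Gamma> z"
    using l norm_entry_velocity[of z] by (simp add: norm_mult)
qed

text \<open>
  A second exit point further along the same ray is impossible, because the first one, a boundary
  point, would lie in the open chord.
\<close>

lemma chord_step_unique:
  assumes "chord_step \<Omega> \<Gamma> L z z1" "chord_step \<Omega> \<Gamma> L z z1'"
  shows "z1 = z1'"
proof -
  have not_beyond: False
    if st: "chord_step \<Omega> \<Gamma> L z w" and l: "0 < l" "l < l'"
      and w: "\<Gamma> (fst w) = \<Gamma> (fst z) + of_real l' * entry_velocity \<Gamma> z"
      and x: "\<Gamma> x = \<Gamma> (fst z) + of_real l * entry_velocity \<Gamma> z" for w l l' x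
  proof -
    have "\<Gamma> x = (1 - l / l') *\<^sub>R \<Gamma> (fst z) + (l / l') *\<^sub>R \<Gamma> (fst w)"
      using l by (simp add: w x scaleR_conv_of_real field_simps)
    moreover have "\<Gamma> (fst z) \<noteq> \<Gamma> (fst w)"
      using chord_step_velocity(1)[OF st] by simp
    ultimately have "\<Gamma> x \<in> open_segment (\<Gamma> (fst z)) (\<Gamma> (fst w))"
      using l by (auto simp: in_segment intro!: exI[of _ "l / l'"])
    with st boundary_notin_table show False
      by (auto simp: chord_step_def)
  qed
  obtain l l' where l: "l > 0" "\<Gamma> (fst z1) = \<Gamma> (fst z) + of_real l * entry_velocity \<Gamma> z"
    and l': "l' > 0" "\<Gamma> (fst z1') = \<Gamma> (fst z) + of_real l' * entry_velocity \<Gamma> z"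
    using assms by (auto simp: chord_step_def)
  have "l = l'"
    using not_beyond[OF assms(1) l'(1) _ l(2) l'(2)] not_beyond[OF assms(2) l(1) _ l'(2) l(2)]
    by (metis linorder_neqE)
  with l l' have "\<Gamma> (fst z1) = \<Gamma> (fst z1')" by simp
  then have "fst z1 = fst z1'"
    by (rule boundary_injective) (use assms in \<open>auto simp: chord_step_def abs_less_iff\<close>)
  then show ?thesis
    by (rule exit_state_unique) (use assms in \<open>auto simp: chord_step_def\<close>)
qed

text \<open>
  At a first return the velocity points strictly into the table, so an arc that goes on
  enters the table at once and cannot have a later endpoint.
\<close>

lemma arc_step_unique:
  assumes "\<mu> > 0" "arc_step \<Omega> \<Gamma> L \<mu> z z2" "arc_step \<Omega> \<Gamma> L \<mu> z z2'"
  shows "z2 = z2'"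
proof -
  let ?c = "larmor \<mu> (\<Gamma> (fst z)) (exit_velocity \<Gamma> z)"
  have not_beyond: "\<not> \<tau> < \<tau>'"
    if \<tau>: "0 < \<tau>" "\<Gamma> (fst w) = ?c \<tau>" "entry_velocity \<Gamma> w = cis \<tau> * exit_velocity \<Gamma> z"
      and w: "snd w \<in> {0<..<pi}" and out: "\<forall>\<phi>\<in>{0<..<\<tau>'}. ?c \<phi> \<notin> \<Omega>" for \<tau> \<tau>' w
  proof
    assume less: "\<tau> < \<tau>'"
    have "cnj (tangent \<Gamma> (fst w)) * (of_real \<mu> * (cis \<tau> * exit_velocity \<Gamma> z))
        = of_real \<mu> * cis (snd w)"
      by (metis \<tau>(3) cnj_tangent_mult_entry_velocity mult.left_commute)
    moreover have "Im (of_real \<mu> * cis (snd w)) > 0"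
      using \<open>\<mu> > 0\<close> w by (simp add: sin_gt_zero)
    ultimately have "Im (cnj (tangent \<Gamma> (fst w)) * (of_real \<mu> * (cis \<tau> * exit_velocity \<Gamma> z))) > 0"
      by (simp only:)
    then have "\<forall>\<^sub>F t in at_right \<tau>. ?c t \<in> \<Omega>"
      by (intro inward_curve_enters_table[OF has_vector_derivative_larmor])
        (simp_all add: \<tau>(2))
    moreover have "\<forall>\<^sub>F t in at_right \<tau>. t \<in> {\<tau><..<\<tau>'}"
      using less by (rule eventually_at_right_real)
    ultimately have "\<forall>\<^sub>F t in at_right \<tau>. False"
      by eventually_elim (use out \<tau>(1) in auto)
    then show False by (simp add: trivial_limit_at_right_real)
  qed
  obtain \<tau> \<tau>' where \<tau>: "0 < \<tau>" "\<Gamma> (fst z2) = ?c \<tau>" "entry_velocity \<Gamma> z2 = cis \<tau> * exit_velocity \<Gamma> z"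
      "\<forall>\<phi>\<in>{0<..<\<tau>}. ?c \<phi> \<notin> \<Omega>"
    and \<tau>': "0 < \<tau>'" "\<Gamma> (fst z2') = ?c \<tau>'" "entry_velocity \<Gamma> z2' = cis \<tau>' * exit_velocity \<Gamma> z"
      "\<forall>\<phi>\<in>{0<..<\<tau>'}. ?c \<phi> \<notin> \<Omega>"
    using assms(2,3) unfolding arc_step_def by blast
  have ang: "snd z2 \<in> {0<..<pi}" "snd z2' \<in> {0<..<pi}"
    using assms(2,3) by (auto simp: arc_step_def)
  have "\<tau> = \<tau>'"
    using not_beyond[OF \<tau>(1-3) ang(1) \<tau>'(4)] not_beyond[OF \<tau>'(1-3) ang(2) \<tau>(4)] by linarith
  have "fst z2 = fst z2'"
    by (rule boundary_injective)
      (use assms \<tau> \<tau>' \<open>\<tau> = \<tau>'\<close> in \<open>auto simp: arc_step_def abs_less_iff\<close>)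
  then show ?thesis
    by (rule entry_state_unique) (use \<tau> \<tau>' \<open>\<tau> = \<tau>'\<close> ang in auto)
qed

lemma billiard_map_eq:
  assumes "\<mu> > 0" "chord_step \<Omega> \<Gamma> L z z1" "arc_step \<Omega> \<Gamma> L \<mu> z1 z2"
  shows "billiard_map \<Omega> \<Gamma> L \<mu> z = z2"
  unfolding billiard_map_def billiard_step_def
proof (rule the_equality)
  show "\<exists>z1. chord_step \<Omega> \<Gamma> L z z1 \<and> arc_step \<Omega> \<Gamma> L \<mu> z1 z2"
    using assms by blast
  show "w = z2" if "\<exists>z1. chord_step \<Omega> \<Gamma> L z z1 \<and> arc_step \<Omega> \<Gamma> L \<mu> z1 w" for w
    using that assms chord_step_unique arc_step_unique by metis
qed

text \<open>
  Every pair of distinct boundary points spans a chord, with angles given by the arc cosine. This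
  is what makes the pairs of end parameters usable as coordinates on the phase space.
\<close>

lemma chord_step_between:
  assumes "x < y" "y < x + L"
  defines "V \<equiv> sgn (\<Gamma> y - \<Gamma> x)"
  shows "chord_step \<Omega> \<Gamma> L (x, arccos (Re (cnj (tangent \<Gamma> x) * V)))
      (y, arccos (Re (cnj V * tangent \<Gamma> y)))" (is "chord_step _ _ _ ?z ?z'")
    and "entry_velocity \<Gamma> (x, arccos (Re (cnj (tangent \<Gamma> x) * V))) = V"
    and "exit_velocity \<Gamma> (y, arccos (Re (cnj V * tangent \<Gamma> y))) = V"
proof -
  have ne: "\<Gamma> x \<noteq> \<Gamma> y"
    using boundary_injective[of x y] assms by auto
  then have V: "norm V = 1"
    by (simp add: V_def norm_sgn)
  then have unit: "norm (cnj (tangent \<Gamma> x) * V) = 1" "norm (cnj V * tangent \<Gamma> y) = 1"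
    by (simp_all add: norm_mult norm_tangent)
  have l: "\<Gamma> y - \<Gamma> x = of_real (norm (\<Gamma> y - \<Gamma> x)) * V"
    using ne by (simp add: V_def sgn_div_norm scaleR_conv_of_real)
  have "Im (cnj (tangent \<Gamma> x) * (of_real (norm (\<Gamma> y - \<Gamma> x)) * V)) > 0"
    using boundary_left_of_tangent[of y x] ne unfolding l[symmetric] by simp
  then have "norm (\<Gamma> y - \<Gamma> x) * Im (cnj (tangent \<Gamma> x) * V) > 0"
    by (simp add: algebra_simps)
  then have "Im (cnj (tangent \<Gamma> x) * V) > 0"
    using ne by (simp add: zero_less_mult_iff)
  note entry = upper_unit_circle_angle[OF unit(1) this]
  have "\<Gamma> x - \<Gamma> y = - (of_real (norm (\<Gamma> y - \<Gamma> x)) * V)"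
    by (metis l minus_diff_eq)
  then have "Im (cnj (tangent \<Gamma> y) * - (of_real (norm (\<Gamma> y - \<Gamma> x)) * V)) > 0"
    using boundary_left_of_tangent[of x y] ne by metis
  then have "norm (\<Gamma> y - \<Gamma> x) * Im (cnj V * tangent \<Gamma> y) > 0"
    by (simp add: algebra_simps)
  then have "Im (cnj V * tangent \<Gamma> y) > 0"
    using ne by (simp add: zero_less_mult_iff)
  note exit = upper_unit_circle_angle[OF unit(2) this]
  show ev: "entry_velocity \<Gamma> ?z = V"
    unfolding entry_velocity_def fst_conv snd_conv entry(2)
    using tangent_mult_cnj[of x] by algebra
  have "cis (- arccos (Re (cnj V * tangent \<Gamma> y))) = V * cnj (tangent \<Gamma> y)"
    using exit(2) by (metis cis_cnj complex_cnj_cnj complex_cnj_mult)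
  then show xv: "exit_velocity \<Gamma> ?z' = V"
    unfolding exit_velocity_def fst_conv snd_conv
    using cnj_tangent_mult[of y] by algebra
  have "open_segment (\<Gamma> x) (\<Gamma> y) \<subseteq> \<Omega>"
    using open_segment_in_table boundary_in_closure ne by metis
  moreover have "\<exists>l>0. \<Gamma> y = \<Gamma> x + of_real l * V"
    using ne l by (intro exI[of _ "norm (\<Gamma> y - \<Gamma> x)"]) (simp add: algebra_simps)
  ultimately show "chord_step \<Omega> \<Gamma> L ?z ?z'"
    unfolding chord_step_def ev xv using assms entry(1) exit(1) by simp
qed

text \<open>
  The four displacements add up to zero. With \<open>v\<close> and \<open>w\<close> the velocities on the two chords, the
  arcs contribute \<open>\<mu> * \<i> * (v - w)\<close> and \<open>\<mu> * \<i> * (w - v)\<close>, which cancel. What remains are two positive multiples of unit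
  vectors with sum zero.
\<close>

lemma closed_double_step_antiparallel:
  assumes "chord_step \<Omega> \<Gamma> L z0 z1" "arc_step \<Omega> \<Gamma> L \<mu> z1 z2"
    and "chord_step \<Omega> \<Gamma> L z2 z3" "arc_step \<Omega> \<Gamma> L \<mu> z3 z4"
    and "\<Gamma> (fst z4) = \<Gamma> (fst z0)" "entry_velocity \<Gamma> z4 = entry_velocity \<Gamma> z0"
  shows "entry_velocity \<Gamma> z2 = - entry_velocity \<Gamma> z0"
    and "norm (\<Gamma> (fst z3) - \<Gamma> (fst z2)) = norm (\<Gamma> (fst z1) - \<Gamma> (fst z0))"
proof -
  define l where "l = norm (\<Gamma> (fst z1) - \<Gamma> (fst z0))"
  define l' where "l' = norm (\<Gamma> (fst z3) - \<Gamma> (fst z2))"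
  let ?v = "entry_velocity \<Gamma> z0" and ?w = "entry_velocity \<Gamma> z2"
  have v: "exit_velocity \<Gamma> z1 = ?v" and w: "exit_velocity \<Gamma> z3 = ?w"
    using assms by (auto simp: chord_step_def)
  have "\<Gamma> (fst z1) = \<Gamma> (fst z0) + of_real l * ?v" "\<Gamma> (fst z3) = \<Gamma> (fst z2) + of_real l' * ?w"
    unfolding l_def l'_def by (rule chord_step_velocity(3), fact)+
  moreover note arc_step_same_centre[OF assms(2), unfolded v]
    arc_step_same_centre[OF assms(4), unfolded w assms(5,6)]
  ultimately have sum: "of_real l * ?v + of_real l' * ?w = 0"
    by algebra
  then have "norm (of_real l * ?v) = norm (of_real l' * ?w)"
    by (metis add_eq_0_iff norm_minus_cancel)
  then have eq: "l = l'"
    by (simp add: norm_mult norm_entry_velocity l_def l'_def)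
  have "l > 0"
    using chord_step_velocity(1)[OF assms(1)] by (simp add: l_def)
  have "of_real l * (?v + ?w) = 0" using sum eq by (simp add: algebra_simps)
  then have "?v + ?w = 0" using \<open>l > 0\<close> by simp
  then show "?w = - ?v" by (simp add: eq_neg_iff_add_eq_0 add.commute)
  show "norm (\<Gamma> (fst z3) - \<Gamma> (fst z2)) = norm (\<Gamma> (fst z1) - \<Gamma> (fst z0))"
    using eq by (simp add: l_def l'_def)
qed

text \<open>
  A boundary point on the normal to the left of the velocity lies to the left of the tangent only
  if the angle between velocity and tangent is acute.
\<close>

lemma cot_entry_angle_pos:
  assumes "\<Gamma> t - \<Gamma> (fst z) = of_real c * \<i> * entry_velocity \<Gamma> z" "c > 0" "snd z \<in> {0<..<pi}"
  shows "cot (snd z) > 0"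
proof -
  have "\<Gamma> t \<noteq> \<Gamma> (fst z)"
    using assms(1,2) norm_entry_velocity[of z] by auto
  from boundary_left_of_tangent[OF this] have "Im (of_real c * \<i> * cis (snd z)) > 0"
    unfolding assms(1) by (metis cnj_tangent_mult_entry_velocity mult.left_commute)
  with assms(2,3) show ?thesis
    by (simp add: cot_def zero_less_mult_iff sin_gt_zero)
qed

lemma cot_exit_angle_pos:
  assumes "\<Gamma> t - \<Gamma> (fst z) = of_real c * \<i> * exit_velocity \<Gamma> z" "c > 0" "snd z \<in> {0<..<pi}"
  shows "cot (snd z) > 0"
proof -
  have "\<Gamma> t \<noteq> \<Gamma> (fst z)"
    using assms(1,2) norm_tangent[of "fst z"] by (auto simp: exit_velocity_def simp del: norm_tangent)
  from boundary_left_of_tangent[OF this] have "Im (of_real c * \<i> * cis (- snd z)) > 0"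
    unfolding assms(1) by (metis cnj_tangent_mult_exit_velocity mult.left_commute)
  with assms(2,3) show ?thesis
    by (simp add: cot_def zero_less_mult_iff sin_gt_zero)
qed

section \<open>The linearized billiard map\<close>

lemma derivative_tangent:
  "vector_derivative (tangent \<Gamma>) (at s) = \<i> * of_real (curvature \<Gamma> s) * tangent \<Gamma> s"
  unfolding curvature_def
  by (rule unit_vector_derivative_orthogonal[OF has_vector_derivative_tangent])
    (simp add: norm_tangent)

lemma has_vector_derivative_boundary_along:
  assumes "(X has_real_derivative p) (at t)"
  shows "((\<lambda>t. \<Gamma> (X t)) has_vector_derivative of_real p * tangent \<Gamma> (X t)) (at t)"
  using vector_diff_chain_at[OF _ has_vector_derivative_boundary, of X p t] assms
  by (simp add: o_def has_real_derivative_iff_has_vector_derivative scaleR_conv_of_real)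

lemma has_vector_derivative_tangent_along:
  assumes "(X has_real_derivative p) (at t)"
  shows "((\<lambda>t. tangent \<Gamma> (X t)) has_vector_derivative
    \<i> * of_real (p * curvature \<Gamma> (X t)) * tangent \<Gamma> (X t)) (at t)"
  using vector_diff_chain_at[OF _ has_vector_derivative_tangent, of X p t] assms
  by (simp add: o_def has_real_derivative_iff_has_vector_derivative scaleR_conv_of_real
      derivative_tangent mult_ac)

text \<open>
  The chord vector is the length times the direction. Differentiating this product and taking the
  component transverse to the chord removes the derivative of the length and leaves the length
  times the angular speed of the direction.
\<close>

lemma has_vector_derivative_chord_direction:
  fixes p q :: real
  assumes chord: "chord_step \<Omega> \<Gamma> L z0 z1"
  defines "l \<equiv> norm (\<Gamma> (fst z1) - \<Gamma> (fst z0))"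
  defines "V \<equiv> \<lambda>t. sgn (\<Gamma> (fst z1 + q * t) - \<Gamma> (fst z0 + p * t))"
  shows "(V has_vector_derivative
      \<i> * of_real ((sin (snd z0) * p + sin (snd z1) * q) / l) * entry_velocity \<Gamma> z0) (at 0)"
proof -
  define D where "D t = \<Gamma> (fst z1 + q * t) - \<Gamma> (fst z0 + p * t)" for t
  define n where "n t = norm (D t)" for t
  let ?v = "entry_velocity \<Gamma> z0"
  have ne: "D 0 \<noteq> 0" and V0: "V 0 = ?v" and l: "l > 0" "n 0 = l"
    using chord_step_velocity[OF chord] by (simp_all add: D_def V_def l_def n_def)
  have D': "(D has_vector_derivative
      of_real q * tangent \<Gamma> (fst z1) - of_real p * tangent \<Gamma> (fst z0)) (at 0)"
  proof -
    have "((\<lambda>t. \<Gamma> (s + c * t)) has_vector_derivative of_real c * tangent \<Gamma> s) (at 0)" for s c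
    proof -
      have "((\<lambda>t. s + c * t) has_real_derivative c) (at 0)"
        by (auto intro!: derivative_eq_intros)
      from has_vector_derivative_boundary_along[OF this] show ?thesis by simp
    qed
    then show ?thesis
      unfolding D_def[abs_def] by (intro has_vector_derivative_diff)
  qed
  then have "D differentiable (at 0)"
    by (auto simp: has_vector_derivative_def differentiable_def)
  then have "n differentiable (at 0)"
    unfolding n_def[abs_def]
    using differentiable_compose[of norm D 0 UNIV] differentiable_norm_at[OF ne] by simp
  then obtain n' where n': "(n has_real_derivative n') (at 0)"
    by (auto simp: real_differentiable_def)
  have VD: "V = (\<lambda>t. inverse (n t) *\<^sub>R D t)"
    by (simp add: V_def D_def n_def sgn_div_norm)
  have "((\<lambda>t. inverse (n t)) has_real_derivative - (inverse l * n' * inverse l)) (at 0)"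
    using DERIV_inverse'[OF n'] l by simp
  from has_vector_derivative_scaleR[OF this D'] obtain V' where
    V': "(V has_vector_derivative V') (at 0)"
    unfolding VD by blast
  have "isCont D 0"
    using D' by (rule has_vector_derivative_continuous)
  then have nz: "\<forall>\<^sub>F t in nhds 0. D t \<noteq> 0"
    using ne by (simp add: isCont_def tendsto_imp_eventually_ne tendsto_nhds_iff eventually_nhds_conv_at)
  then have "\<forall>\<^sub>F t in nhds 0. norm (V t) = 1"
    by eventually_elim (simp add: V_def D_def norm_sgn)
  from unit_vector_derivative_orthogonal[OF V' this]
  obtain b where b: "V' = \<i> * of_real b * ?v"
    unfolding V0 by blast
  have "((\<lambda>t. n t *\<^sub>R V t) has_vector_derivative n 0 *\<^sub>R V' + n' *\<^sub>R V 0) (at 0)"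
    using has_vector_derivative_scaleR[OF n' V'] .
  moreover have "(\<lambda>t. n t *\<^sub>R V t) = D"
  proof
    show "n t *\<^sub>R V t = D t" for t
      by (cases "D t = 0") (simp_all add: VD n_def)
  qed
  ultimately have "of_real q * tangent \<Gamma> (fst z1) - of_real p * tangent \<Gamma> (fst z0)
      = of_real l * (\<i> * of_real b * ?v) + of_real n' * ?v"
    using vector_derivative_unique_at[OF D'] l by (simp add: b V0 scaleR_conv_of_real)
  moreover have "tangent \<Gamma> (fst z0) = cis (- snd z0) * ?v"
    by (simp add: entry_velocity_def cis_mult mult.assoc[symmetric])
  moreover have "tangent \<Gamma> (fst z1) = cis (snd z1) * ?v"
  proof -
    have "?v = exit_velocity \<Gamma> z1" using chord by (simp add: chord_step_def)
    then show ?thesis by (simp add: exit_velocity_def cis_mult mult.assoc[symmetric])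
  qed
  ultimately have "(of_real q * cis (snd z1) - of_real p * cis (- snd z0)) * ?v
      = (of_real l * (\<i> * of_real b) + of_real n') * ?v"
    by (simp only: left_diff_distrib distrib_right mult.assoc)
  moreover have "?v \<noteq> 0"
    using norm_entry_velocity[of z0] by auto
  ultimately have "of_real q * cis (snd z1) - of_real p * cis (- snd z0)
      = of_real l * (\<i> * of_real b) + of_real n'"
    by (metis mult_right_cancel)
  from arg_cong[OF this, of Im] have "q * sin (snd z1) + p * sin (snd z0) = l * b"
    by simp
  then have "b = (sin (snd z0) * p + sin (snd z1) * q) / l"
    using l by (simp add: field_simps)
  with V' b show ?thesis by simp
qed

text \<open>
  The angle of \<open>V\<close> with the tangent changes at the angular speed \<open>b\<close> of \<open>V\<close> minus that of the
  tangent.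
\<close>

lemma has_real_derivative_entry_momentum:
  assumes X: "(X has_real_derivative p) (at t)"
    and V: "(V has_vector_derivative \<i> * of_real b * V t) (at t)"
    and ang: "V t = cis \<theta> * tangent \<Gamma> (X t)"
  shows "((\<lambda>t. - Re (cnj (tangent \<Gamma> (X t)) * V t)) has_real_derivative
    sin \<theta> * (b - curvature \<Gamma> (X t) * p)) (at t)"
proof -
  let ?g = "tangent \<Gamma> (X t)"
  have "((\<lambda>t. cnj (tangent \<Gamma> (X t)) * V t) has_vector_derivative
      cnj ?g * (\<i> * of_real b * V t) + cnj (\<i> * of_real (p * curvature \<Gamma> (X t)) * ?g) * V t) (at t)"
    by (intro has_vector_derivative_mult V has_vector_derivative_cnj
        has_vector_derivative_tangent_along X)
  moreover have "cnj ?g * (\<i> * of_real b * V t) + cnj (\<i> * of_real (p * curvature \<Gamma> (X t)) * ?g) * V t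
      = \<i> * of_real (b - p * curvature \<Gamma> (X t)) * (cnj ?g * V t)"
    by (simp add: algebra_simps)
  moreover have "cnj ?g * V t = cis \<theta>"
    using cnj_tangent_mult[of "X t"] unfolding ang by algebra
  ultimately have "((\<lambda>t. cnj (tangent \<Gamma> (X t)) * V t) has_vector_derivative
      \<i> * of_real (b - p * curvature \<Gamma> (X t)) * cis \<theta>) (at t)"
    by simp
  from bounded_linear.has_vector_derivative[OF bounded_linear_Re this]
  have "((\<lambda>t. Re (cnj (tangent \<Gamma> (X t)) * V t)) has_real_derivative
      - ((b - p * curvature \<Gamma> (X t)) * sin \<theta>)) (at t)"
    by (simp only: has_real_derivative_iff_has_vector_derivative) simp
  from DERIV_minus[OF this] show ?thesis
    by (simp add: mult.commute)
qed

lemma has_vector_derivative_entry_velocity_along: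
  assumes X: "(X has_real_derivative p) (at t)" and \<theta>: "(\<theta> has_real_derivative r) (at t)"
  shows "((\<lambda>t. entry_velocity \<Gamma> (X t, \<theta> t)) has_vector_derivative
    \<i> * of_real (r + p * curvature \<Gamma> (X t)) * entry_velocity \<Gamma> (X t, \<theta> t)) (at t)"
proof -
  have "((\<lambda>t. cis (\<theta> t)) has_vector_derivative r *\<^sub>R (\<i> * cis (\<theta> t))) (at t)"
    using vector_diff_chain_at[OF _ has_vector_derivative_cis, of \<theta> r t] \<theta>
    by (simp add: o_def has_real_derivative_iff_has_vector_derivative)
  from has_vector_derivative_mult[OF this has_vector_derivative_tangent_along[OF X]]
  show ?thesis
    by (simp add: entry_velocity_def scaleR_conv_of_real algebra_simps)
qed

text \<open>
  The numbers \<open>p\<close> and \<open>q\<close> are the speeds of the two ends of the chord and \<open>b\<close> is the resulting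
  angular speed of its direction; \<open>w\<close> is the velocity of the image state. The two equations are the
  components, transverse to and along the chord, of the differentiated equation between the two
  expressions for the centre of the Larmor circle. In the second one the factor of \<open>\<mu>\<close> on the
  left is the angular speed of the velocity on re-entry.
\<close>

lemma billiard_map_linearization:
  fixes p q :: real
  assumes chord: "chord_step \<Omega> \<Gamma> L z0 z1" and arc: "arc_step \<Omega> \<Gamma> L \<mu> z1 z2"
    and \<mu>: "\<mu> > 0" and diff: "billiard_differentiable \<Omega> \<Gamma> L \<mu> z0"
    and anti: "entry_velocity \<Gamma> z2 = - entry_velocity \<Gamma> z0"
  defines "l \<equiv> norm (\<Gamma> (fst z1) - \<Gamma> (fst z0))"
  defines "b \<equiv> (sin (snd z0) * p + sin (snd z1) * q) / l"
  defines "w \<equiv> DT \<Omega> \<Gamma> L \<mu> z0 *v vector [p, sin (snd z0) * (b - curvature \<Gamma> (fst z0) * p)]"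
  shows "sin (snd z2) * w $ 1 = sin (snd z1) * q"
    and "\<mu> * (w $ 2 / sin (snd z2) + curvature \<Gamma> (fst z2) * w $ 1)
      = cos (snd z1) * q + cos (snd z2) * w $ 1 - \<mu> * b"
proof -
  \<comment> \<open>\<open>A t\<close> is the entry state of the chord from \<open>X t\<close> to \<open>Y t\<close> in the coordinates \<open>(s, u)\<close>, and
    \<open>B t\<close> its image; the exit angle never has to be differentiated.\<close>
  define X where "X t = fst z0 + p * t" for t
  define Y where "Y t = fst z1 + q * t" for t
  define V where "V t = sgn (\<Gamma> (Y t) - \<Gamma> (X t))" for t
  define A where "A t = (vector [X t, - Re (cnj (tangent \<Gamma> (X t)) * V t)] :: real^2)" for t
  define B where "B t = billiard_map_su \<Omega> \<Gamma> L \<mu> (A t)" for t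
  define \<theta> where "\<theta> t = arccos (- (B t $ 2))" for t
  let ?v = "entry_velocity \<Gamma> z0"
  have \<theta>012: "snd z0 \<in> {0<..<pi}" "snd z1 \<in> {0<..<pi}" "snd z2 \<in> {0<..<pi}"
    using chord arc by (auto simp: chord_step_def arc_step_def)
  then have sin_pos: "sin (snd z2) > 0" by (simp add: sin_gt_zero)
  have X': "(X has_real_derivative p) (at t)" and Y': "(Y has_real_derivative q) (at t)" for t
    unfolding X_def Y_def by (auto intro!: derivative_eq_intros)
  have X0: "X 0 = fst z0" and Y0: "Y 0 = fst z1" by (simp_all add: X_def Y_def)
  have V0: "V 0 = ?v"
    using chord_step_velocity(2)[OF chord] by (simp add: V_def X0 Y0)
  have V': "(V has_vector_derivative \<i> * of_real b * V 0) (at 0)"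
    using has_vector_derivative_chord_direction[OF chord, of q p] unfolding V0
    by (simp add: V_def[abs_def] X_def Y_def b_def l_def)
  have A0: "A 0 = to_su z0"
    unfolding A_def to_su_def X0 V0
    by (simp only: cnj_tangent_mult_entry_velocity cis.sel)
  have A': "(A has_vector_derivative vector [p, sin (snd z0) * (b - curvature \<Gamma> (fst z0) * p)]) (at 0)"
  proof -
    have u': "((\<lambda>t. - Re (cnj (tangent \<Gamma> (X t)) * V t)) has_real_derivative
        sin (snd z0) * (b - curvature \<Gamma> (X 0) * p)) (at 0)"
      by (rule has_real_derivative_entry_momentum[OF X' V']) (simp add: V0 X0 entry_velocity_def)
    show ?thesis
      unfolding A_def[abs_def] X0[symmetric]
      by (rule has_vector_derivative_vector_2[OF X' u'])
  qed
  have B': "(B has_vector_derivative w) (at 0)"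
  proof -
    have "(billiard_map_su \<Omega> \<Gamma> L \<mu> has_derivative ((*v) (DT \<Omega> \<Gamma> L \<mu> z0))) (at (A 0))"
      using diff unfolding billiard_differentiable_def DT_def A0 jacobian_works by blast
    from vector_derivative_diff_chain_within[OF A' has_derivative_at_withinI[OF this]]
    show ?thesis
      by (simp add: B_def[abs_def] o_def w_def)
  qed
  have B1': "((\<lambda>t. B t $ 1) has_real_derivative w $ 1) (at 0)"
    and B2': "((\<lambda>t. B t $ 2) has_real_derivative w $ 2) (at 0)"
    using bounded_linear.has_vector_derivative[OF bounded_linear_vec_nth B']
    by (simp_all add: has_real_derivative_iff_has_vector_derivative)
  have of_to: "of_su (to_su z) = z" if "snd z \<in> {0<..<pi}" for z
    using that by (simp add: of_su_def to_su_def arccos_cos)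
  have B0: "B 0 = to_su z2"
    by (simp add: B_def A0 billiard_map_su_def of_to[OF \<theta>012(1)] billiard_map_eq[OF \<mu> chord arc])
  have \<theta>0: "\<theta> 0 = snd z2"
    using \<theta>012 by (simp add: \<theta>_def B0 to_su_def arccos_cos)
  have \<theta>': "(\<theta> has_real_derivative w $ 2 / sin (snd z2)) (at 0)"
  proof -
    have c: "- (B 0 $ 2) = cos (snd z2)" by (simp add: B0 to_su_def)
    have bd: "\<bar>cos (snd z2)\<bar> < 1"
      using sin_pos sin_cos_squared_add[of "snd z2"]
      by (metis abs_square_less_1 less_add_same_cancel2 zero_less_power)
    have "sqrt (1 - (cos (snd z2))\<^sup>2) = sin (snd z2)"
      using sin_pos by (simp add: sin_squared_eq[symmetric])
    then have "(arccos has_real_derivative inverse (- sin (snd z2))) (at (- (B 0 $ 2)))"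
      using DERIV_arccos[of "cos (snd z2)"] bd unfolding c by (simp add: abs_less_iff)
    from DERIV_chain2[OF this DERIV_minus[OF B2']] show ?thesis
      by (simp add: \<theta>_def[abs_def] divide_inverse mult.commute)
  qed
  have "isCont A 0"
    using A' by (rule has_vector_derivative_continuous)
  then have "filterlim A (nhds (A 0)) (nhds 0)"
    by (simp add: isCont_def tendsto_at_iff_tendsto_nhds)
  moreover have "\<forall>\<^sub>F x in nhds (A 0). of_su x \<in> billiard_dom \<Omega> \<Gamma> L \<mu>"
    using diff by (simp add: billiard_differentiable_def A0)
  ultimately have "\<forall>\<^sub>F t in nhds 0. of_su (A t) \<in> billiard_dom \<Omega> \<Gamma> L \<mu>"
    by (rule eventually_compose_filterlim[rotated])
  moreover have "\<forall>\<^sub>F t in nhds 0. X t < Y t \<and> Y t < X t + L"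
  proof -
    have "isCont X 0" "isCont Y 0"
      using X' Y' DERIV_isCont by blast+
    then have "((\<lambda>t. Y t - X t) \<longlongrightarrow> Y 0 - X 0) (nhds 0)"
      by (intro tendsto_diff) (simp_all add: isCont_def tendsto_at_iff_tendsto_nhds)
    moreover have "0 < Y 0 - X 0" "Y 0 - X 0 < L"
      using chord by (auto simp: chord_step_def X0 Y0)
    ultimately have "\<forall>\<^sub>F t in nhds 0. 0 < Y t - X t" "\<forall>\<^sub>F t in nhds 0. Y t - X t < L"
      by (blast dest: order_tendstoD)+
    then show ?thesis
      by eventually_elim auto
  qed
  \<comment> \<open>Near the given chord, the image of \<open>A t\<close> is reached through the exit state at \<open>Y t\<close>, because
    chord and arc are unique; so both ends of the arc see the same centre.\<close>
  ultimately have centres: "\<forall>\<^sub>F t in nhds 0. \<Gamma> (Y t) + of_real \<mu> * \<i> * V t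
      = \<Gamma> (B t $ 1) + of_real \<mu> * \<i> * entry_velocity \<Gamma> (B t $ 1, \<theta> t)"
  proof eventually_elim
    case (elim t)
    let ?z0 = "(X t, arccos (Re (cnj (tangent \<Gamma> (X t)) * V t)))"
    let ?z1 = "(Y t, arccos (Re (cnj (V t) * tangent \<Gamma> (Y t))))"
    note between = chord_step_between[of "X t" "Y t", folded V_def]
    have "of_su (A t) = ?z0"
      by (simp add: of_su_def A_def add.commute)
    with elim obtain z1' z2' where "chord_step \<Omega> \<Gamma> L ?z0 z1'" and arc': "arc_step \<Omega> \<Gamma> L \<mu> z1' z2'"
      by (auto simp: billiard_dom_def billiard_step_def)
    moreover have "chord_step \<Omega> \<Gamma> L ?z0 ?z1"
      using elim by (intro between(1)) auto
    ultimately have z1': "z1' = ?z1" and map: "billiard_map \<Omega> \<Gamma> L \<mu> ?z0 = z2'"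
      using chord_step_unique billiard_map_eq[OF \<mu>] by blast+
    have "B t = to_su z2'"
      using map \<open>of_su (A t) = ?z0\<close> by (simp add: B_def billiard_map_su_def)
    moreover have "snd z2' \<in> {0<..<pi}"
      using arc' by (simp add: arc_step_def)
    ultimately have "z2' = (B t $ 1, \<theta> t)"
      by (simp add: \<theta>_def to_su_def arccos_cos prod_eq_iff)
    moreover have "exit_velocity \<Gamma> ?z1 = V t"
      using elim by (intro between(3)) auto
    ultimately show ?case
      using arc_step_same_centre[OF arc'] unfolding z1' by simp
  qed
  have "((\<lambda>t. \<Gamma> (B t $ 1) + of_real \<mu> * \<i> * entry_velocity \<Gamma> (B t $ 1, \<theta> t)) has_vector_derivative
        of_real (w $ 1) * tangent \<Gamma> (B 0 $ 1) + of_real \<mu> * \<i> *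
        (\<i> * of_real (w $ 2 / sin (snd z2) + w $ 1 * curvature \<Gamma> (B 0 $ 1))
          * entry_velocity \<Gamma> (B 0 $ 1, \<theta> 0))) (at 0)"
    by (intro has_vector_derivative_add has_vector_derivative_mult_right
        has_vector_derivative_boundary_along has_vector_derivative_entry_velocity_along B1' \<theta>')
  then have "((\<lambda>t. \<Gamma> (Y t) + of_real \<mu> * \<i> * V t) has_vector_derivative
        of_real (w $ 1) * tangent \<Gamma> (B 0 $ 1) + of_real \<mu> * \<i> *
        (\<i> * of_real (w $ 2 / sin (snd z2) + w $ 1 * curvature \<Gamma> (B 0 $ 1))
          * entry_velocity \<Gamma> (B 0 $ 1, \<theta> 0))) (at 0)"
    by (rule has_vector_derivative_cong_ev[THEN iffD2, rotated 2])
      (use centres eventually_nhds_x_imp_x[OF centres] in simp_all)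
  moreover have "((\<lambda>t. \<Gamma> (Y t) + of_real \<mu> * \<i> * V t) has_vector_derivative
        of_real q * tangent \<Gamma> (Y 0) + of_real \<mu> * \<i> * (\<i> * of_real b * V 0)) (at 0)"
    by (intro has_vector_derivative_add has_vector_derivative_mult_right
        has_vector_derivative_boundary_along Y' V')
  ultimately have "of_real q * tangent \<Gamma> (fst z1) + of_real \<mu> * \<i> * (\<i> * of_real b * ?v)
      = of_real (w $ 1) * tangent \<Gamma> (fst z2) + of_real \<mu> * \<i> *
        (\<i> * of_real (w $ 2 / sin (snd z2) + w $ 1 * curvature \<Gamma> (fst z2)) * entry_velocity \<Gamma> z2)"
    using vector_derivative_unique_at
    by (fastforce simp: B0 \<theta>0 V0 Y0 to_su_def)
  moreover have "tangent \<Gamma> (fst z1) = cis (snd z1) * ?v"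
  proof -
    have "?v = exit_velocity \<Gamma> z1" using chord by (simp add: chord_step_def)
    then show ?thesis by (simp add: exit_velocity_def cis_mult mult.assoc[symmetric])
  qed
  moreover have "tangent \<Gamma> (fst z2) = - cis (- snd z2) * ?v"
  proof -
    have "tangent \<Gamma> (fst z2) = cis (- snd z2) * entry_velocity \<Gamma> z2"
      by (simp add: entry_velocity_def cis_mult mult.assoc[symmetric])
    then show ?thesis by (simp add: anti)
  qed
  ultimately have "(of_real q * cis (snd z1) - of_real (\<mu> * b)) * ?v
      = (of_real (\<mu> * (w $ 2 / sin (snd z2) + w $ 1 * curvature \<Gamma> (fst z2)))
        - of_real (w $ 1) * cis (- snd z2)) * ?v"
    unfolding anti by (simp only: of_real_mult) (use i_squared in algebra)
  moreover have "?v \<noteq> 0"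
    using norm_entry_velocity[of z0] by auto
  ultimately have eq: "of_real q * cis (snd z1) - of_real (\<mu> * b)
      = of_real (\<mu> * (w $ 2 / sin (snd z2) + w $ 1 * curvature \<Gamma> (fst z2)))
        - of_real (w $ 1) * cis (- snd z2)"
    by (metis mult_right_cancel)
  from arg_cong[OF eq, of Im] show "sin (snd z2) * w $ 1 = sin (snd z1) * q"
    by (simp add: mult.commute)
  from arg_cong[OF eq, of Re]
  show "\<mu> * (w $ 2 / sin (snd z2) + curvature \<Gamma> (fst z2) * w $ 1)
      = cos (snd z1) * q + cos (snd z2) * w $ 1 - \<mu> * b"
    by (simp add: mult.commute)
qed

text \<open>
  Any tangent vector \<open>x\<close> at the entry state is realized by a motion of the two ends of the chord:
  the rotation \<open>b\<close> is read off from \<open>x\<close>, and \<open>q\<close> is the speed of the far end that produces it. The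
  cotangents appear when the tangential components on both ends of the arc are expressed by the
  common transverse displacement \<open>l * b - sin (snd z0) * x $ 1\<close>.
\<close>

lemma DT_in_beam_frame:
  assumes \<mu>: "\<mu> > 0" and chord: "chord_step \<Omega> \<Gamma> L z0 z1" and arc: "arc_step \<Omega> \<Gamma> L \<mu> z1 z2"
    and diff: "billiard_differentiable \<Omega> \<Gamma> L \<mu> z0"
    and anti: "entry_velocity \<Gamma> z2 = - entry_velocity \<Gamma> z0"
  shows "beam_frame (curvature \<Gamma> (fst z2)) (snd z2) ** DT \<Omega> \<Gamma> L \<mu> z0
    = reversal_matrix (norm (\<Gamma> (fst z1) - \<Gamma> (fst z0))) ((cot (snd z1) + cot (snd z2)) / \<mu>)
      ** beam_frame (curvature \<Gamma> (fst z0)) (snd z0)"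
  unfolding matrix_eq
proof
  fix x :: "real^2"
  define l where "l = norm (\<Gamma> (fst z1) - \<Gamma> (fst z0))"
  define b where "b = curvature \<Gamma> (fst z0) * x $ 1 + x $ 2 / sin (snd z0)"
  define q where "q = (l * b - sin (snd z0) * x $ 1) / sin (snd z1)"
  define w where "w = DT \<Omega> \<Gamma> L \<mu> z0 *v x"
  have l: "l > 0"
    using chord_step_velocity(1)[OF chord] by (simp add: l_def)
  have sins: "sin (snd z0) > 0" "sin (snd z1) > 0" "sin (snd z2) > 0"
    using chord arc by (auto simp: chord_step_def arc_step_def intro: sin_gt_zero)
  have b: "b = (sin (snd z0) * x $ 1 + sin (snd z1) * q) / l"
    using sins l by (simp add: q_def)
  have "vector [x $ 1, sin (snd z0) * (b - curvature \<Gamma> (fst z0) * x $ 1)] = x"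
    using sins by (simp add: vec_eq_iff forall_2 b_def)
  note lin = billiard_map_linearization[OF chord arc \<mu> diff anti, of "x $ 1" q,
      folded l_def, folded b, unfolded this, folded w_def]
  have perp: "sin (snd z2) * w $ 1 = l * b - sin (snd z0) * x $ 1"
    using lin(1) sins by (simp add: q_def)
  have "cos (snd z1) * q + cos (snd z2) * w $ 1
      = (cot (snd z1) + cot (snd z2)) * (l * b - sin (snd z0) * x $ 1)"
  proof -
    have "cos (snd z1) * q = cot (snd z1) * (l * b - sin (snd z0) * x $ 1)"
      by (simp add: q_def cot_def)
    moreover have "cos (snd z2) * w $ 1 = cot (snd z2) * (sin (snd z2) * w $ 1)"
      using sins by (simp add: cot_def)
    ultimately show ?thesis by (simp add: perp distrib_right)
  qed
  with lin(2) have turn: "curvature \<Gamma> (fst z2) * w $ 1 + w $ 2 / sin (snd z2)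
      = (cot (snd z1) + cot (snd z2)) / \<mu> * (l * b - sin (snd z0) * x $ 1) - b"
    using \<mu> by (simp add: field_simps)
  have in_frame: "beam_frame \<kappa> \<theta> *v y = vector [sin \<theta> * y $ 1, \<kappa> * y $ 1 + y $ 2 / sin \<theta>]" for \<kappa> \<theta> y
    by (simp add: vec_eq_iff forall_2 matrix_vector_mult_def sum_2 beam_frame_def)
  have rev: "reversal_matrix l c *v y = vector [l * y $ 2 - y $ 1, c * (l * y $ 2 - y $ 1) - y $ 2]" for c y
    by (simp add: vec_eq_iff forall_2 matrix_vector_mult_def sum_2 reversal_matrix_def algebra_simps)
  show "beam_frame (curvature \<Gamma> (fst z2)) (snd z2) ** DT \<Omega> \<Gamma> L \<mu> z0 *v x
      = reversal_matrix (norm (\<Gamma> (fst z1) - \<Gamma> (fst z0))) ((cot (snd z1) + cot (snd z2)) / \<mu>)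
        ** beam_frame (curvature \<Gamma> (fst z0)) (snd z0) *v x"
    unfolding matrix_vector_mul_assoc[symmetric] l_def[symmetric] w_def[symmetric] in_frame rev
      perp turn by (simp add: b_def)
qed

end

section \<open>Stability of 2-periodic trajectories\<close>

theorem theorem3p4:
  fixes \<Omega> :: "complex set" and \<Gamma> :: "real \<Rightarrow> complex" and L \<mu> :: real
    and s0 s1 s2 s3 \<theta>0 \<theta>1 \<theta>2 \<theta>3 l1 \<alpha> \<beta> \<delta> m M :: real
  assumes "billiard_table \<Omega> \<Gamma> L" and "\<mu> > 0"
    and "two_periodic_trajectory \<Omega> \<Gamma> L \<mu> (s0, \<theta>0) (s1, \<theta>1) (s2, \<theta>2) (s3, \<theta>3)"
    and "billiard_differentiable \<Omega> \<Gamma> L \<mu> (s0, \<theta>0)"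
    and "billiard_differentiable \<Omega> \<Gamma> L \<mu> (billiard_map \<Omega> \<Gamma> L \<mu> (s0, \<theta>0))"
    and "l1 = dist (\<Gamma> s0) (\<Gamma> s1)"
    and "\<alpha> = l1 / \<mu>"
    and "\<beta> = cot \<theta>0 + cot \<theta>3"
    and "\<delta> = cot \<theta>1 + cot \<theta>2"
    and "m = min (2 / \<beta>) (2 / \<delta>)"
    and "M = max (2 / \<beta>) (2 / \<delta>)"
  shows "\<alpha> > 0 \<and> \<beta> > 0 \<and> \<delta> > 0 \<and>
    (\<beta> \<noteq> \<delta> \<longrightarrow>
       (parabolic \<Omega> \<Gamma> L \<mu> (s0, \<theta>0) \<longleftrightarrow> \<alpha> = m \<or> \<alpha> = M \<or> \<alpha> = m + M) \<and>
       (elliptic \<Omega> \<Gamma> L \<mu> (s0, \<theta>0) \<longleftrightarrow> \<alpha> \<in> {0<..<m} \<union> {M<..<m + M}) \<and>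
       (hyperbolic \<Omega> \<Gamma> L \<mu> (s0, \<theta>0) \<longleftrightarrow> \<alpha> \<in> {m<..<M} \<union> {m + M<..})) \<and>
    (\<beta> = \<delta> \<longrightarrow> m = M \<and>
       (parabolic \<Omega> \<Gamma> L \<mu> (s0, \<theta>0) \<longleftrightarrow> \<alpha> = m \<or> \<alpha> = 2 * m) \<and>
       (elliptic \<Omega> \<Gamma> L \<mu> (s0, \<theta>0) \<longleftrightarrow> \<alpha> \<in> {0<..<m} \<union> {m<..<2 * m}) \<and>
       (hyperbolic \<Omega> \<Gamma> L \<mu> (s0, \<theta>0) \<longleftrightarrow> \<alpha> \<in> {2 * m<..}))"
proof -
  note table = assms(1) and \<mu> = assms(2)
  let ?z0 = "(s0, \<theta>0)" and ?z1 = "(s1, \<theta>1)" and ?z2 = "(s2, \<theta>2)" and ?z3 = "(s3, \<theta>3)"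
  have steps: "chord_step \<Omega> \<Gamma> L ?z0 ?z1" "arc_step \<Omega> \<Gamma> L \<mu> ?z1 ?z2" "chord_step \<Omega> \<Gamma> L ?z2 ?z3"
    and per: "period_two \<Omega> \<Gamma> L \<mu> ?z0"
    using assms(3) by (auto simp: two_periodic_trajectory_def)
  have angles: "\<theta>0 \<in> {0<..<pi}" "\<theta>1 \<in> {0<..<pi}" "\<theta>2 \<in> {0<..<pi}" "\<theta>3 \<in> {0<..<pi}"
    using steps by (auto simp: chord_step_def)
  have T0: "billiard_map \<Omega> \<Gamma> L \<mu> ?z0 = ?z2"
    by (rule billiard_map_eq[OF table \<mu> steps(1,2)])
  obtain z3' z4 where "chord_step \<Omega> \<Gamma> L ?z2 z3'" "arc_step \<Omega> \<Gamma> L \<mu> z3' z4"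
    using per unfolding period_two_def T0 billiard_dom_def billiard_step_def by blast
  then have arc3: "arc_step \<Omega> \<Gamma> L \<mu> ?z3 z4"
    using chord_step_unique[OF table steps(3)] by metis
  have "billiard_map \<Omega> \<Gamma> L \<mu> ?z2 = z4"
    by (rule billiard_map_eq[OF table \<mu> steps(3) arc3])
  then have "same_state L z4 ?z0"
    using per by (simp add: period_two_def T0)
  then obtain k :: int where "s0 = fst z4 + of_int k * L" and z4: "snd z4 = \<theta>0"
    by (auto simp: same_state_def)
  then have closes: "\<Gamma> (fst z4) = \<Gamma> s0" "tangent \<Gamma> (fst z4) = tangent \<Gamma> s0"
    "curvature \<Gamma> (fst z4) = curvature \<Gamma> s0"
    using boundary_shift[OF table] tangent_shift[OF table] tangent_derivative_shift[OF table]
    by (simp_all add: curvature_def)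
  then have v4: "entry_velocity \<Gamma> z4 = entry_velocity \<Gamma> ?z0"
    by (simp add: entry_velocity_def z4)
  define v where "v = entry_velocity \<Gamma> ?z0"
  have v2: "entry_velocity \<Gamma> ?z2 = - v" and l3: "norm (\<Gamma> s3 - \<Gamma> s2) = norm (\<Gamma> s1 - \<Gamma> s0)"
    using closed_double_step_antiparallel[OF table steps arc3] closes(1) v4 by (simp_all add: v_def)
  have v13: "exit_velocity \<Gamma> ?z1 = v" "exit_velocity \<Gamma> ?z3 = - v"
    using steps(1,3) v2 by (auto simp: chord_step_def v_def)
  \<comment> \<open>the two sides of the rectangle spanned by the half circles\<close>
  have side12: "\<Gamma> s2 - \<Gamma> s1 = of_real (2 * \<mu>) * \<i> * v"
    using arc_step_same_centre[OF steps(2)] v2 v13 by (simp add: algebra_simps)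
  have side30: "\<Gamma> s0 - \<Gamma> s3 = of_real (2 * \<mu>) * \<i> * - v"
    using arc_step_same_centre[OF arc3] v4 v13 closes(1) by (simp add: v_def[symmetric] algebra_simps)
  have "cot \<theta>0 > 0"
    using cot_entry_angle_pos[OF table, of s3 ?z0 "2 * \<mu>"] side30 \<mu> angles
    by (simp add: v_def[symmetric] algebra_simps)
  moreover have "cot \<theta>2 > 0"
    using cot_entry_angle_pos[OF table, of s1 ?z2 "2 * \<mu>"] side12 \<mu> angles v2
    by (simp add: algebra_simps)
  moreover have "cot \<theta>1 > 0"
    using cot_exit_angle_pos[OF table, of s2 ?z1 "2 * \<mu>"] side12 \<mu> angles v13 by simp
  moreover have "cot \<theta>3 > 0"
    using cot_exit_angle_pos[OF table, of s0 ?z3 "2 * \<mu>"] side30 \<mu> angles v13 by simp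
  ultimately have pos: "\<beta> > 0" "\<delta> > 0"
    by (simp_all add: assms(8,9))
  have l1: "l1 = norm (\<Gamma> s1 - \<Gamma> s0)"
    by (simp add: assms(6) dist_norm norm_minus_commute)
  have \<alpha>: "\<alpha> > 0"
    using chord_step_velocity(1)[OF table steps(1)] \<mu> by (simp add: assms(7) l1)
  \<comment> \<open>The frame at \<open>z4\<close> is that at \<open>(s0, \<theta>0)\<close>, so the two conjugations close up.\<close>
  have "beam_frame (curvature \<Gamma> s2) \<theta>2 ** DT \<Omega> \<Gamma> L \<mu> ?z0
      = reversal_matrix l1 (\<delta> / \<mu>) ** beam_frame (curvature \<Gamma> s0) \<theta>0"
    using DT_in_beam_frame[OF table \<mu> steps(1,2) assms(4)] v2
    by (simp add: v_def l1 assms(9))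
  moreover have "beam_frame (curvature \<Gamma> s0) \<theta>0 ** DT \<Omega> \<Gamma> L \<mu> ?z2
      = reversal_matrix l1 (\<beta> / \<mu>) ** beam_frame (curvature \<Gamma> s2) \<theta>2"
    using DT_in_beam_frame[OF table \<mu> steps(3) arc3 assms(5)[unfolded T0]] v2 v4
    by (simp add: v_def l1 l3 closes(3) z4 assms(8) add.commute)
  ultimately have "trace (stability_matrix \<Omega> \<Gamma> L \<mu> ?z0)
      = trace (reversal_matrix l1 (\<beta> / \<mu>) ** reversal_matrix l1 (\<delta> / \<mu>))"
    unfolding stability_matrix_def T0
    by (intro trace_cyclic_conjugation[OF invertible_beam_frame[OF angles(1)]])
  also have "\<dots> = 2 - 2 * \<alpha> * (\<beta> + \<delta>) + \<alpha>\<^sup>2 * \<beta> * \<delta>"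
    using \<mu> by (simp add: trace_reversal_matrix_mult assms(7) field_simps power2_eq_square)
  finally have tr: "trace (stability_matrix \<Omega> \<Gamma> L \<mu> ?z0) = 2 - 2 * \<alpha> * (\<beta> + \<delta>) + \<alpha>\<^sup>2 * \<beta> * \<delta>" .
  note classes = stability_classification[OF \<alpha> pos tr assms(10,11),
      folded parabolic_def elliptic_def hyperbolic_def]
  have "m = M" if "\<beta> = \<delta>"
    using that by (simp add: assms(10,11))
  with classes \<alpha> pos show ?thesis
    by auto
qed

end
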